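(* Let $f\in H^\infty$ have no zeros in $\mathbb{D}$ and satisfy $\|f\|_{H^\infty}\le1$, and let $\nu=\nu_f$ be its associated Herglotz–Nevanlinna measure. Then $1/f\in\mathcal{B}$ if and only if there exists a constant $C=C(f)>0$ such that for any pair of contiguous arcs $I,I'\subset\partial\mathbb{D}$ of the same length, $$\left|\frac{\nu(I)}{|I|}-\frac{\nu(I')}{|I'|}\right|\le C\exp\left(-\frac{\nu(I)}{|I|}\right).$$
   Context: If $f\in H^\infty$ has no zeros in $\mathbb{D}$, write $f=FS_\mu$ with $F$ outer and $S_\mu$ singular inner with singular measure $\mu$; the Herglotz–Nevanlinna measure is $d\nu_f=-\log|f(\zeta)|\,dm(\zeta)+d\mu(\zeta)$, $m$ normalized Lebesgue measure. $|I|$ is normalized arc length; contiguous arcs have disjoint interiors and a common endpoint. $\mathcal{B}$ is the Bloch space of analytic $g$ on $\mathbb{D}$ with $|g(0)|+\sup_z(1-|z|)|g'(z)|<\infty$. *)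

theory Defs
  imports "HOL-Analysis.Analysis"
begin

definition circ :: "real \<Rightarrow> complex" where
  "circ t = exp (2 * of_real pi * \<i> * of_real t)"

text \<open>The arc starting at normalised position a of normalised length l
  (half-open), so its normalised length |I| is l (for 0 < l \<le> 1).\<close>
definition arc :: "real \<Rightarrow> real \<Rightarrow> complex set" where
  "arc a l = circ ` {a..<a+l}"

text \<open>Poisson kernel w.r.t. normalised Lebesgue measure on the circle.\<close>
definition poisson_kernel :: "complex \<Rightarrow> complex \<Rightarrow> real" where
  "poisson_kernel z \<zeta> = (1 - (cmod z)^2) / (cmod (\<zeta> - z))^2"

definition Hinf_unit_ball :: "(complex \<Rightarrow> complex) \<Rightarrow> bool" where
  "Hinf_unit_ball f \<longleftrightarrow> f holomorphic_on ball 0 1 \<and> (\<forall>z\<in>ball 0 1. cmod (f z) \<le> 1)"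

text \<open>Herglotz--Nevanlinna measure of a zero-free f with |f| \<le> 1: the finite positive
  Borel measure on the unit circle whose Poisson integral is -log|f|
  (equivalently -log|f| dm + d mu for f = F S_mu).\<close>
definition HN_measure :: "(complex \<Rightarrow> complex) \<Rightarrow> complex measure \<Rightarrow> bool" where
  "HN_measure f \<nu> \<longleftrightarrow>
     sets \<nu> = sets borel \<and> space \<nu> = UNIV \<and> finite_measure \<nu> \<and>
     emeasure \<nu> (- sphere 0 1) = 0 \<and>
     (\<forall>z\<in>ball 0 1. integrable \<nu> (poisson_kernel z) \<and>
        - ln (cmod (f z)) = (\<integral>\<zeta>. poisson_kernel z \<zeta> \<partial>\<nu>))"

definition bloch :: "(complex \<Rightarrow> complex) \<Rightarrow> bool" where
  "bloch g \<longleftrightarrow> g holomorphic_on ball 0 1 \<and>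
     (\<exists>B. \<forall>z\<in>ball 0 1. (1 - cmod z) * cmod (deriv g z) \<le> B)"

end

(*
  Let Q be the Herglotz transform of nu, so that f = k exp (-Q) with |k| = 1 and
  |(1/f)'| = |Q'| exp (Re Q), where Re Q is the Poisson integral of nu.
  In both directions the decisive point is that exponentiating linearises the problem:
  e^{nu(I)/|I|} changes by a bounded amount when I is doubled, respectively
  e^Q = const / f is Lipschitz for the hyperbolic metric. Hence the factor exp (- nu(I)/|I|)
  (respectively exp (- Re Q)) grows only logarithmically with the number of scales, and that
  is summable against the kernels involved.

  From arcs to Bloch: the distribution function of nu differs from its chord on an arc I by
  O(|I| exp (- nu(I)/|I|)) (evaluate the second difference at the extremum of the deviation),
  and integration by parts against zeta/(zeta - z)^2 and against the Poisson kernel bounds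
  Q'(z) and Re Q(z) - nu(I)/|I|.

  From Bloch to arcs: in the half-plane coordinate z = exp (2 pi i w), a primitive Psi of Q has
  first-order Taylor error O(l exp (- Re Q(w0))) at boundary points within distance O(l) of w0,
  Im w0 = l; differences of Re Psi on horizontal lines converge to masses of arcs.
*)
theory Submission
  imports Defs "HOL-Complex_Analysis.Complex_Analysis" "HOL-Real_Asymp.Real_Asymp"
begin

section \<open>Functions with exponentially small second differences\<close>

text \<open>The obstacle is that nu(J)/|J| is unbounded, and the estimate at one point involves the
  errors exp (- nu(J)/|J|) of many arcs J, while only exp (- nu(I)/|I|) for a single arc I is
  allowed in the result. The normalisation |f| \<le> 1 decides this: it makes nu(J)/|J| and Re Q
  nonnegative, and for x \<ge> 0 an additive bound |e^x - e^y| \<le> D implies the multiplicative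
  one e^(-x) \<le> (1 + D) e^(-y). The logarithm D is then replaced by a small power of the ratio of
  scales, chosen so that everything left over stays integrable. A second point is atoms. The
  extremum argument needs a continuous distribution function, and boundary limits of Poisson
  integrals give the mass of an arc only if its endpoints carry none. Each side of the equivalence
  therefore first yields that nu has no atoms.\<close>

definition exp_zygmund :: "real \<Rightarrow> real set \<Rightarrow> (real \<Rightarrow> real) \<Rightarrow> bool" where
  "exp_zygmund C S N \<longleftrightarrow> (\<forall>t l. 0 < l \<longrightarrow> {t - l..t + l} \<subseteq> S \<longrightarrow>
     \<bar>N (t + l) - 2 * N t + N (t - l)\<bar> \<le> C * l * exp (- ((N (t + l) - N t) / l)) \<and>
     \<bar>N (t + l) - 2 * N t + N (t - l)\<bar> \<le> C * l * exp (- ((N t - N (t - l)) / l)))"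

lemma exp_zygmundD:
  assumes "exp_zygmund C S N" "0 < l" "{t - l..t + l} \<subseteq> S"
  shows "\<bar>N (t + l) - 2 * N t + N (t - l)\<bar> \<le> C * l * exp (- ((N (t + l) - N t) / l))"
    and "\<bar>N (t + l) - 2 * N t + N (t - l)\<bar> \<le> C * l * exp (- ((N t - N (t - l)) / l))"
  using assms unfolding exp_zygmund_def by blast+

lemma exp_zygmund_subset: "exp_zygmund C S N \<Longrightarrow> T \<subseteq> S \<Longrightarrow> exp_zygmund C T N"
  unfolding exp_zygmund_def by blast

text \<open>Reflection exchanges the mean to the left of a point with the mean to its right. Because
  the definition asks for both bounds, it is invariant, and estimates to the left of a point follow
  from those to its right.\<close>

lemma exp_zygmund_reflect:
  assumes "exp_zygmund C S N"
  shows "exp_zygmund C (uminus ` S) (\<lambda>t. c - N (- t))"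
  unfolding exp_zygmund_def
proof (intro allI impI)
  fix t l :: real
  assume l: "0 < l" and sub: "{t - l..t + l} \<subseteq> uminus ` S"
  have "{- t - l..- t + l} \<subseteq> S"
  proof
    fix x assume "x \<in> {- t - l..- t + l}"
    then have "- x \<in> uminus ` S" using sub by auto
    then show "x \<in> S" by auto
  qed
  note z = exp_zygmundD[OF assms l this]
  have e: "\<bar>c - N (- (t + l)) - 2 * (c - N (- t)) + (c - N (- (t - l)))\<bar>
     = \<bar>N (- t + l) - 2 * N (- t) + N (- t - l)\<bar>"
  proof -
    have "- (t + l) = - t - l" "- (t - l) = - t + l" by simp_all
    then show ?thesis by (simp only:) (simp add: abs_if)
  qed
  show "\<bar>c - N (- (t + l)) - 2 * (c - N (- t)) + (c - N (- (t - l)))\<bar>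
      \<le> C * l * exp (- ((c - N (- (t + l)) - (c - N (- t))) / l)) \<and>
      \<bar>c - N (- (t + l)) - 2 * (c - N (- t)) + (c - N (- (t - l)))\<bar>
      \<le> C * l * exp (- ((c - N (- t) - (c - N (- (t - l)))) / l))"
  proof -
    have "- (t + l) = - t - l" "- (t - l) = - t + l" by simp_all
    then show ?thesis unfolding e using z by (simp only:) simp
  qed
qed

text \<open>Let D be the deviation from the chord; it vanishes at both ends. At an interior maximum
  M take for l the distance to the nearer end: one of D (M - l), D (M + l) is 0 and the other is at
  most D M, so the second difference is at most - D M. The minimum is symmetric.\<close>

lemma exp_zygmund_chord:
  fixes N :: "real \<Rightarrow> real"
  assumes C: "0 \<le> C" and ab: "a < b" and cont: "continuous_on {a..b} N"
    and zyg: "exp_zygmund C {a..b} N" and t: "t \<in> {a..b}"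
  defines "A \<equiv> (N b - N a) / (b - a)"
  shows "\<bar>N t - N a - A * (t - a)\<bar> \<le> C * (b - a) / 2 * exp (- A)"
proof -
  define D where "D = (\<lambda>t. N t - N a - A * (t - a))"
  have D0: "D a = 0" "D b = 0" using ab by (auto simp: D_def A_def)
  have contD: "continuous_on {a..b} D" unfolding D_def by (intro continuous_intros cont)
  have slope: "(N y - N x) / l = A + (D y - D x) / l" if "y - x = l" "0 < l" for x y l
  proof -
    have "N y - N x = A * l + (D y - D x)"
      using that by (simp add: D_def algebra_simps flip: that(1))
    then show ?thesis using that by (simp add: field_simps)
  qed
  have diff: "N (x + l) - 2 * N x + N (x - l) = D (x + l) - 2 * D x + D (x - l)" for x l
    by (simp add: D_def algebra_simps)
  have nonneg: "0 \<le> C * (b - a) / 2 * exp (- A)" using C ab by simp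
  have final: "C * l * exp (- (A + y)) \<le> C * (b - a) / 2 * exp (- A)"
    if "0 \<le> y" "0 < l" "l \<le> (b - a) / 2" for l y
  proof -
    have "C * l * exp (- (A + y)) \<le> C * ((b - a) / 2) * exp (- A)"
      using that C by (intro mult_mono) auto
    then show ?thesis by simp
  qed
  have ex: "\<exists>l>0. l \<le> (b - a) / 2 \<and> {x - l..x + l} \<subseteq> {a..b} \<and> (x - l = a \<or> x + l = b)"
    if "a < x" "x < b" for x
    using that by (intro exI[of _ "min (x - a) (b - x)"]) (auto simp: min_def field_simps)
  obtain M where M: "M \<in> {a..b}" "\<And>x. x \<in> {a..b} \<Longrightarrow> D x \<le> D M"
    using continuous_attains_sup[OF _ _ contD] ab by auto
  obtain m where m: "m \<in> {a..b}" "\<And>x. x \<in> {a..b} \<Longrightarrow> D m \<le> D x"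
    using continuous_attains_inf[OF _ _ contD] ab by auto
  have "D M \<le> C * (b - a) / 2 * exp (- A)"
  proof (cases "M = a \<or> M = b")
    case True then show ?thesis using D0 nonneg by auto
  next
    case False
    then obtain l where l: "0 < l" "l \<le> (b - a) / 2" "{M - l..M + l} \<subseteq> {a..b}"
        "M - l = a \<or> M + l = b" using ex[of M] M(1) by auto
    have in_: "M - l \<in> {a..b}" "M + l \<in> {a..b}" using l by auto
    have "D M \<le> \<bar>D (M + l) - 2 * D M + D (M - l)\<bar>"
      using l(4) D0 M(2)[OF in_(1)] M(2)[OF in_(2)] by auto
    \<comment> \<open>As D (M - l) \<le> D M, the mean to the left of M is at least A, so its
      exponential is at most exp (- A). At the minimum the mean to the right has this
      property.\<close>
    also have "\<dots> \<le> C * l * exp (- (A + (D M - D (M - l)) / l))"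
      using exp_zygmundD(2)[OF zyg l(1,3)] slope[of M "M - l" l] l(1) diff by simp
    also have "\<dots> \<le> C * (b - a) / 2 * exp (- A)"
      using M(2)[OF in_(1)] l by (intro final) auto
    finally show ?thesis .
  qed
  moreover have "- D m \<le> C * (b - a) / 2 * exp (- A)"
  proof (cases "m = a \<or> m = b")
    case True then show ?thesis using D0 nonneg by auto
  next
    case False
    then obtain l where l: "0 < l" "l \<le> (b - a) / 2" "{m - l..m + l} \<subseteq> {a..b}"
        "m - l = a \<or> m + l = b" using ex[of m] m(1) by auto
    have in_: "m - l \<in> {a..b}" "m + l \<in> {a..b}" using l by auto
    have "- D m \<le> \<bar>D (m + l) - 2 * D m + D (m - l)\<bar>"
      using l(4) D0 m(2)[OF in_(1)] m(2)[OF in_(2)] by auto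
    also have "\<dots> \<le> C * l * exp (- (A + (D (m + l) - D m) / l))"
      using exp_zygmundD(1)[OF zyg l(1,3)] slope[of "m + l" m l] l(1) diff by simp
    also have "\<dots> \<le> C * (b - a) / 2 * exp (- A)"
      using m(2)[OF in_(2)] l by (intro final) auto
    finally show ?thesis .
  qed
  ultimately show ?thesis using M(2)[OF t] m(2)[OF t] unfolding D_def by linarith
qed

section \<open>Elementary inequalities for exp and ln\<close>

lemma abs_exp_diff_le:
  fixes x y d :: real
  assumes "\<bar>x - y\<bar> \<le> d"
  shows "\<bar>exp x - exp y\<bar> \<le> exp (y + d) * d"
proof -
  have *: "exp u - exp v \<le> exp u * (u - v)" for u v :: real
    using exp_ge_add_one_self[of "v - u"] mult_left_mono[of "1 + (v - u)" "exp (v - u)" "exp u"]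
    by (simp add: exp_diff algebra_simps)
  have d: "0 \<le> d" using assms by linarith
  have "exp x - exp y \<le> exp (y + d) * d" if "y \<le> x"
  proof -
    have "exp x * (x - y) \<le> exp (y + d) * d" using assms that by (intro mult_mono) auto
    then show ?thesis using *[of x y] by linarith
  qed
  moreover have "exp y - exp x \<le> exp (y + d) * d" if "x \<le> y"
  proof -
    have "exp y * (y - x) \<le> exp (y + d) * d" using assms that d by (intro mult_mono) auto
    then show ?thesis using *[of y x] by linarith
  qed
  ultimately show ?thesis
    by (smt (verit) d exp_ge_zero mult_nonneg_nonneg exp_le_cancel_iff)
qed

text \<open>Undoes the exponential. For x < y convexity gives only the factor exp (- x); since x
  \<ge> 0, exp y \<le> exp x + D \<le> (1 + D) exp x, which trades it for exp (- y).\<close>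

lemma abs_diff_le_exp:
  fixes x y :: real
  assumes "0 \<le> x" "\<bar>exp x - exp y\<bar> \<le> D"
  shows "\<bar>x - y\<bar> \<le> D * (1 + D) * exp (- y)"
proof -
  have D: "0 \<le> D" using assms by linarith
  have *: "u - v \<le> (exp u - exp v) * exp (- v)" for u v :: real
    using exp_ge_add_one_self[of "u - v"] by (simp add: exp_diff exp_minus field_simps)
  have "exp y \<le> exp x + D" using assms by linarith
  also have "\<dots> \<le> exp x * (1 + D)" using assms D by (simp add: algebra_simps mult_le_cancel_left1)
  finally have e: "exp (- x) \<le> (1 + D) * exp (- y)" by (simp add: exp_minus field_simps)
  have "x - y \<le> D * exp (- y)"
    by (rule order.trans[OF *[of x y] mult_right_mono]) (use assms in auto)
  also have "\<dots> \<le> D * (1 + D) * exp (- y)"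
    using D by (intro mult_right_mono) (auto simp: mult_le_cancel_left1)
  finally have 1: "x - y \<le> D * (1 + D) * exp (- y)" .
  have "y - x \<le> D * exp (- x)"
    by (rule order.trans[OF *[of y x] mult_right_mono]) (use assms in auto)
  also have "\<dots> \<le> D * ((1 + D) * exp (- y))"
    using D e by (intro mult_left_mono) auto
  finally show ?thesis using 1 by (simp add: mult.assoc)
qed

text \<open>A fourth root, because the bound is inserted for D in D (1 + D) of
  \<open>abs_diff_le_exp\<close>; its square is then only a square root of the ratio of
  scales.\<close>

lemma ln_le_fourth_root:
  fixes x :: real assumes "1 \<le> x"
  shows "1 + 2 * ln x \<le> 8 * sqrt (sqrt x)"
proof -
  have "ln (sqrt (sqrt x)) \<le> sqrt (sqrt x) - 1" using assms by (intro ln_le_minus_one) auto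
  then show ?thesis using assms by (simp add: ln_sqrt)
qed

text \<open>Halve s until it is at most 2 d. By the chord bound on {0..b}, passing from b to any r
  in {b/2..b} changes the mean by at most C exp (- F b / b), hence its exponential by at most C exp
  C, and the number of halvings is logarithmic.\<close>

lemma exp_zygmund_mean_growth:
  fixes F :: "real \<Rightarrow> real"
  assumes C: "0 \<le> C" and d: "0 < d" and cont: "continuous_on {0..L} F" and F0: "F 0 = 0"
    and nonneg: "\<And>t. t \<in> {0..L} \<Longrightarrow> 0 \<le> F t" and zyg: "exp_zygmund C {0..L} F"
    and s: "d \<le> s" "s \<le> L"
  shows "\<bar>exp (F s / s) - exp (F d / d)\<bar> \<le> C * exp C * (1 + 2 * ln (s / d))"
proof -
  define c where "c = C * exp C"
  have c: "0 \<le> c" using C by (simp add: c_def)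
  have step: "\<bar>exp (F r / r) - exp (F b / b)\<bar> \<le> c"
    if "0 < b" "b \<le> L" "b / 2 \<le> r" "r \<le> b" for r b
  proof -
    have sub: "{0..b} \<subseteq> {0..L}" using that by auto
    have "\<bar>F r - F b / b * r\<bar> \<le> C * b / 2 * exp (- (F b / b))"
      using exp_zygmund_chord[OF C that(1) continuous_on_subset[OF cont sub]
          exp_zygmund_subset[OF zyg sub], of r] that F0 by simp
    also have "\<dots> \<le> C * r * exp (- (F b / b))"
      using that C mult_left_mono[of "b / 2" r C] by (intro mult_right_mono) auto
    finally have "\<bar>F r - F b / b * r\<bar> / r \<le> C * exp (- (F b / b))"
      using that by (simp add: divide_le_eq mult_ac)
    moreover have "\<bar>F r - F b / b * r\<bar> / r = \<bar>F r / r - F b / b\<bar>"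
    proof -
      have "F r / r - F b / b = (F r - F b / b * r) / r" using that by (simp add: field_simps)
      then show ?thesis using that by (simp add: abs_divide)
    qed
    ultimately have "\<bar>F r / r - F b / b\<bar> \<le> C * exp (- (F b / b))" by simp
    then have "\<bar>exp (F r / r) - exp (F b / b)\<bar>
        \<le> exp (F b / b + C * exp (- (F b / b))) * (C * exp (- (F b / b)))"
      by (rule abs_exp_diff_le)
    \<comment> \<open>The factor exp (F b / b) cancels the decay of the chord error, so the cost of
      a halving does not depend on the size of the mean.\<close>
    also have "\<dots> = C * exp (C * exp (- (F b / b)))"
      by (simp add: exp_add exp_minus)
    also have "\<dots> \<le> c"
    proof -
      have "0 \<le> F b / b" using nonneg[of b] that by simp
      then have "C * exp (- (F b / b)) \<le> C * 1" using C by (intro mult_left_mono) auto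
      then show ?thesis using C unfolding c_def by (intro mult_left_mono) auto
    qed
    finally show ?thesis .
  qed
  have "\<forall>s. d \<le> s \<and> s \<le> L \<and> s \<le> 2 ^ k * d \<longrightarrow>
      \<bar>exp (F s / s) - exp (F d / d)\<bar> \<le> c * (1 + 2 * ln (s / d))" for k
  proof (induction k)
    case 0
    then show ?case using c d by (auto intro: mult_nonneg_nonneg)
  next
    case (Suc k)
    show ?case
    proof (intro allI impI)
      fix s assume s: "d \<le> s \<and> s \<le> L \<and> s \<le> 2 ^ Suc k * d"
      show "\<bar>exp (F s / s) - exp (F d / d)\<bar> \<le> c * (1 + 2 * ln (s / d))"
      proof (cases "s \<le> 2 * d")
        case True
        have "\<bar>exp (F d / d) - exp (F s / s)\<bar> \<le> c" using s True d by (intro step) auto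
        moreover have "c * 1 \<le> c * (1 + 2 * ln (s / d))"
          using c s d by (intro mult_left_mono) auto
        ultimately show ?thesis by (simp add: abs_minus_commute)
      next
        case False
        have "\<bar>exp (F (s/2) / (s/2)) - exp (F d / d)\<bar> \<le> c * (1 + 2 * ln (s / 2 / d))"
          using s False d by (intro Suc.IH[rule_format]) auto
        moreover have "\<bar>exp (F (s/2) / (s/2)) - exp (F s / s)\<bar> \<le> c"
          using s False d by (intro step) auto
        ultimately have "\<bar>exp (F s / s) - exp (F d / d)\<bar> \<le> c + c * (1 + 2 * ln (s / 2 / d))"
          by linarith
        also have "\<dots> = c * (2 + 2 * ln (s / d) - 2 * ln 2)"
          using s d by (simp add: ln_div ln_mult algebra_simps)
        \<comment> \<open>2 ln 2 \<ge> 4/3 > 1 pays for the additional halving; hence the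
          coefficient 2 of the logarithm.\<close>
        also have "\<dots> \<le> c * (1 + 2 * ln (s / d))"
          using c ln2_ge_two_thirds by (intro mult_left_mono) auto
        finally show ?thesis .
      qed
    qed
  qed
  moreover obtain k where "s / d < 2 ^ k" using real_arch_pow[of 2 "s / d"] by auto
  then have "s \<le> 2 ^ k * d" using d by (simp add: field_simps)
  ultimately show ?thesis using s unfolding c_def by blast
qed

text \<open>The summand C serves t < d, where the chord bound suffices. The other one is D (1 + D)
  from \<open>abs_diff_le_exp\<close> for D = 8 c y with c = C exp C and y \<ge> 1, after y^2 has
  been taken out.\<close>

definition zyg_const :: "real \<Rightarrow> real" where
  "zyg_const C = C + 8 * (C * exp C) * (1 + 8 * (C * exp C))"

lemma zyg_const_ge: "0 \<le> C \<Longrightarrow> C \<le> zyg_const C"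
  by (simp add: zyg_const_def)

text \<open>The mean at the single scale d predicts F on all of {0..L}. In the weight, the factor d
  + t comes from multiplying a difference of means by t, and the square root is the squared fourth
  root of the ratio of scales.\<close>

lemma exp_zygmund_linear_approx:
  fixes F :: "real \<Rightarrow> real"
  assumes C: "0 \<le> C" and d: "0 < d" "d \<le> L" and cont: "continuous_on {0..L} F" and F0: "F 0 = 0"
    and nonneg: "\<And>t. t \<in> {0..L} \<Longrightarrow> 0 \<le> F t" and zyg: "exp_zygmund C {0..L} F"
    and t: "t \<in> {0..L}"
  shows "\<bar>F t - F d / d * t\<bar>
    \<le> zyg_const C * exp (- (F d / d)) * ((d + t) * sqrt ((d + t) / d))"
proof (cases "d \<le> t")
  case False
  have sub: "{0..d} \<subseteq> {0..L}" using d by auto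
  have "\<bar>F t - F d / d * t\<bar> \<le> C * d / 2 * exp (- (F d / d))"
    using exp_zygmund_chord[OF C d(1) continuous_on_subset[OF cont sub]
          exp_zygmund_subset[OF zyg sub], of t] False t F0 by simp
  also have "\<dots> = C * exp (- (F d / d)) * (d / 2)" by simp
  also have "\<dots> \<le> zyg_const C * exp (- (F d / d)) * ((d + t) * sqrt ((d + t) / d))"
  proof (intro mult_mono)
    have "d / 2 \<le> (d + t) * 1" using d t by auto
    also have "\<dots> \<le> (d + t) * sqrt ((d + t) / d)"
      using d t by (intro mult_left_mono) auto
    finally show "d / 2 \<le> (d + t) * sqrt ((d + t) / d)" .
  qed (use C d zyg_const_ge[OF C] in auto)
  finally show ?thesis .
next
  case True
  define x where "x = t / d"
  define c where "c = C * exp C"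
  have c: "0 \<le> c" using C by (simp add: c_def)
  have x: "1 \<le> x" using True d by (simp add: x_def)
  have t0: "0 < t" using True d by simp
  have "\<bar>exp (F t / t) - exp (F d / d)\<bar> \<le> c * (1 + 2 * ln x)"
    unfolding c_def x_def
    by (rule exp_zygmund_mean_growth[OF C d(1) cont F0 nonneg zyg True]) (use t in auto)
  also have "\<dots> \<le> c * (8 * sqrt (sqrt x))"
    using ln_le_fourth_root[OF x] c by (intro mult_left_mono) auto
  finally have "\<bar>F t / t - F d / d\<bar>
      \<le> c * (8 * sqrt (sqrt x)) * (1 + c * (8 * sqrt (sqrt x))) * exp (- (F d / d))"
    using nonneg[OF t] t0 by (intro abs_diff_le_exp) auto
  also have "\<dots> \<le> (8 * c * (1 + 8 * c) * sqrt x) * exp (- (F d / d))"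
  proof (intro mult_right_mono)
    define y where "y = sqrt (sqrt x)"
    have y: "1 \<le> y" "y * y = sqrt x" using x by (auto simp: y_def simp flip: real_sqrt_mult)
    have "c * (8 * y) * (1 + c * (8 * y)) \<le> c * (8 * y) * (y + c * (8 * y))"
      using y c by (intro mult_left_mono) auto
    also have "\<dots> = 8 * c * (1 + 8 * c) * (y * y)" by (simp add: algebra_simps)
    finally show "c * (8 * sqrt (sqrt x)) * (1 + c * (8 * sqrt (sqrt x))) \<le> 8 * c * (1 + 8 * c) * sqrt x"
      using y(2) unfolding y_def by simp
  qed simp
  also have "\<dots> \<le> zyg_const C * sqrt x * exp (- (F d / d))"
    using C x by (intro mult_right_mono) (auto simp: zyg_const_def c_def)
  finally have "t * \<bar>F t / t - F d / d\<bar> \<le> t * (zyg_const C * sqrt x * exp (- (F d / d)))"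
    using t0 by (intro mult_left_mono) auto
  moreover have "t * \<bar>F t / t - F d / d\<bar> = \<bar>F t - F d / d * t\<bar>"
  proof -
    have "F t - F d / d * t = t * (F t / t - F d / d)" using t0 by (simp add: field_simps)
    then show ?thesis using t0 by (simp add: abs_mult)
  qed
  ultimately have "\<bar>F t - F d / d * t\<bar> \<le> zyg_const C * exp (- (F d / d)) * (t * sqrt x)"
    by (simp add: mult_ac)
  also have "\<dots> \<le> zyg_const C * exp (- (F d / d)) * ((d + t) * sqrt ((d + t) / d))"
    using t0 d C zyg_const_ge[OF C] unfolding x_def
    by (intro mult_left_mono mult_mono) (auto simp: divide_right_mono)
  finally show ?thesis .
qed

text \<open>The means of the two intervals of length d next to 0 differ by at most C exp (- A).
  Replacing one by the other costs the factor exp C in the exponential and the summand C in the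
  slope.\<close>

definition zyg_const2 :: "real \<Rightarrow> real" where
  "zyg_const2 C = zyg_const C * exp C + C"

lemma zyg_const2_ge: "0 \<le> C \<Longrightarrow> zyg_const C \<le> zyg_const2 C"
  using mult_left_mono[of 1 "exp C" "zyg_const C"] zyg_const_ge[of C]
  by (simp add: zyg_const2_def)

text \<open>For t < 0 the one-sided result is applied to the reflected function. Its slope is the
  mean over {-d..0}, and the second difference at 0 with step d compares it with A.\<close>

lemma exp_zygmund_linear_approx2:
  fixes N :: "real \<Rightarrow> real"
  assumes C: "0 \<le> C" and d: "0 < d" "d \<le> L" and cont: "continuous_on {-L..L} N"
    and mono: "mono_on {-L..L} N" and zyg: "exp_zygmund C {-L..L} N" and t: "t \<in> {-L..L}"
  defines "A \<equiv> (N d - N 0) / d"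
  shows "\<bar>N t - N 0 - A * t\<bar> \<le> zyg_const2 C * exp (- A) * ((d + \<bar>t\<bar>) * sqrt ((d + \<bar>t\<bar>) / d))"
proof -
  define W where "W = (d + \<bar>t\<bar>) * sqrt ((d + \<bar>t\<bar>) / d)"
  have W: "\<bar>t\<bar> \<le> W"
  proof -
    have "\<bar>t\<bar> \<le> (d + \<bar>t\<bar>) * 1" using d by simp
    also have "\<dots> \<le> W" unfolding W_def using d by (intro mult_left_mono) auto
    finally show ?thesis .
  qed
  have L: "0 < L" using d by simp
  show ?thesis
  proof (cases "0 \<le> t")
    case True
    have sub: "{0..L} \<subseteq> {-L..L}" using L by auto
    define F where "F = (\<lambda>t. N t - N 0)"
    have "\<bar>F t - F d / d * t\<bar> \<le> zyg_const C * exp (- (F d / d)) * ((d + t) * sqrt ((d + t) / d))"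
    proof (rule exp_zygmund_linear_approx[OF C d])
      show "continuous_on {0..L} F" unfolding F_def
        by (intro continuous_intros continuous_on_subset[OF cont sub])
      show "exp_zygmund C {0..L} F"
        using exp_zygmund_subset[OF zyg sub] by (simp add: F_def exp_zygmund_def algebra_simps)
    qed (use mono_onD[OF mono] True t L in \<open>auto simp: F_def\<close>)
    also have "\<dots> \<le> zyg_const2 C * exp (- (F d / d)) * ((d + t) * sqrt ((d + t) / d))"
      using zyg_const2_ge[OF C] True d by (intro mult_right_mono) auto
    finally show ?thesis using True by (simp add: F_def A_def)
  next
    case False
    have sub: "{-L..0} \<subseteq> {-L..L}" "uminus ` {-L..0} = {0..L}" using L by auto
    define F where "F = (\<lambda>t. N 0 - N (- t))"
    have F: "\<bar>F (-t) - F d / d * (-t)\<bar>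
        \<le> zyg_const C * exp (- (F d / d)) * ((d + (-t)) * sqrt ((d + (-t)) / d))"
    proof (rule exp_zygmund_linear_approx[OF C d])
      show "continuous_on {0..L} F" unfolding F_def
        by (intro continuous_intros continuous_on_compose2[OF cont]) auto
      show "exp_zygmund C {0..L} F"
        using exp_zygmund_reflect[OF exp_zygmund_subset[OF zyg sub(1)]] by (simp add: F_def sub(2))
    qed (use mono_onD[OF mono] False t L in \<open>auto simp: F_def\<close>)
    have "\<bar>N (0 + d) - 2 * N 0 + N (0 - d)\<bar> \<le> C * d * exp (- ((N (0 + d) - N 0) / d))"
      by (rule exp_zygmundD(1)[OF zyg d(1)]) (use d in auto)
    moreover have "A * d = N d - N 0" using d by (simp add: A_def)
    ultimately have "\<bar>A * d - F d\<bar> \<le> C * d * exp (- A)"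
      using d by (simp add: A_def F_def algebra_simps)
    then have "\<bar>A * d - F d\<bar> / d \<le> C * exp (- A)"
      using d by (simp add: divide_le_eq mult_ac)
    moreover have "\<bar>A * d - F d\<bar> / d = \<bar>A - F d / d\<bar>"
    proof -
      have "A - F d / d = (A * d - F d) / d" using d by (simp add: field_simps)
      then show ?thesis using d by (simp add: abs_divide)
    qed
    ultimately have AF: "\<bar>A - F d / d\<bar> \<le> C * exp (- A)" by simp
    have A0: "0 \<le> A" unfolding A_def using mono_onD[OF mono, of 0 d] d by auto
    then have "C * exp (- A) \<le> C * 1" using C by (intro mult_left_mono) auto
    then have e: "exp (- (F d / d)) \<le> exp C * exp (- A)"
      using AF by (simp flip: exp_add)
    have "N t - N 0 - A * t = - (F (-t) - F d / d * (-t)) - t * (A - F d / d)"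
    proof -
      have "N t - N 0 - A * t = - (N 0 - N t - q * (-t)) - t * (A - q)" for q
        by (simp add: algebra_simps)
      from this[of "F d / d"] show ?thesis by (simp add: F_def)
    qed
    then have "\<bar>N t - N 0 - A * t\<bar> \<le> \<bar>F (-t) - F d / d * (-t)\<bar> + \<bar>t\<bar> * \<bar>A - F d / d\<bar>"
      using abs_triangle_ineq4[of "- (F (-t) - F d / d * (-t))" "t * (A - F d / d)"]
      by (simp only: abs_minus_cancel abs_mult)
    also have "\<dots> \<le> zyg_const C * (exp C * exp (- A)) * W + W * (C * exp (- A))"
      using F e AF W C zyg_const_ge[OF C] False d unfolding W_def
      by (intro add_mono order.trans[OF F] mult_mono) (auto intro!: mult_nonneg_nonneg)
    also have "\<dots> = zyg_const2 C * exp (- A) * W" by (simp add: zyg_const2_def algebra_simps)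
    finally show ?thesis unfolding W_def .
  qed
qed

section \<open>Bloch functions on the half-plane\<close>

text \<open>\<open>bnd\<close> is the Bloch condition for exp h on the upper half-plane, since |(exp
  h)'| = |h'| exp (Re h). The intended h is the Herglotz transform in the coordinate w.\<close>

locale half_plane_bloch =
  fixes h h' :: "complex \<Rightarrow> complex" and B :: real
  assumes der: "\<And>w. 0 < Im w \<Longrightarrow> (h has_field_derivative h' w) (at w)"
    and bnd: "\<And>w. 0 < Im w \<Longrightarrow> Im w * (cmod (h' w) * exp (Re (h w))) \<le> B"
    and nonneg: "\<And>w. 0 < Im w \<Longrightarrow> 0 \<le> Re (h w)"
begin

lemma B_nonneg: "0 \<le> B"
proof -
  have "0 \<le> Im \<i> * (cmod (h' \<i>) * exp (Re (h \<i>)))" by simp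
  also have "\<dots> \<le> B" by (rule bnd) simp
  finally show ?thesis .
qed

context
  fixes z0 p :: complex and l :: real
  assumes z0: "Im z0 = l" "0 < l" and p: "0 \<le> Im p" "cmod (p - z0) \<le> 2 * l"
begin

text \<open>Im (seg s) = (1 - s) l + s Im p. As p may lie on the boundary, all bounds along the
  segment are powers or logarithms of 1 - s.\<close>

definition seg :: "real \<Rightarrow> complex" where "seg s = z0 + of_real s * (p - z0)"

lemma seg_0 [simp]: "seg 0 = z0" and seg_1 [simp]: "seg 1 = p"
  by (simp_all add: seg_def)

lemma Im_seg: "0 \<le> s \<Longrightarrow> s < 1 \<Longrightarrow> (1 - s) * l \<le> Im (seg s)"
  using z0 p by (simp add: seg_def algebra_simps)

lemma Im_seg_pos: "0 \<le> s \<Longrightarrow> s < 1 \<Longrightarrow> 0 < Im (seg s)"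
  using Im_seg[of s] z0 by (smt (verit) mult_pos_pos)

lemma seg_deriv: "(seg has_vector_derivative (p - z0)) (at s)"
  unfolding seg_def by (auto intro!: derivative_eq_intros has_vector_derivative_real_field)

lemma h_seg_deriv:
  "0 \<le> s \<Longrightarrow> s < 1 \<Longrightarrow> ((\<lambda>s. h (seg s)) has_vector_derivative (p - z0) * h' (seg s)) (at s)"
  using field_vector_diff_chain_at[OF seg_deriv der[OF Im_seg_pos]] by (simp add: o_def)

lemma h_seg_deriv_bound:
  assumes "0 \<le> s" "s < 1"
  shows "cmod ((p - z0) * h' (seg s)) * exp (Re (h (seg s))) \<le> 2 * B / (1 - s)"
proof -
  have "(1 - s) * l * (cmod (h' (seg s)) * exp (Re (h (seg s))))
      \<le> Im (seg s) * (cmod (h' (seg s)) * exp (Re (h (seg s))))"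
    using Im_seg[OF assms] by (intro mult_right_mono) auto
  also have "\<dots> \<le> B" by (rule bnd[OF Im_seg_pos[OF assms]])
  finally have 1: "l * (cmod (h' (seg s)) * exp (Re (h (seg s)))) \<le> B / (1 - s)"
    using assms by (simp add: field_simps)
  have "cmod ((p - z0) * h' (seg s)) * exp (Re (h (seg s)))
      \<le> 2 * l * (cmod (h' (seg s)) * exp (Re (h (seg s))))"
    unfolding norm_mult mult.assoc[of "cmod (p - z0)"] using p by (intro mult_right_mono) auto
  also have "\<dots> \<le> 2 * (B / (1 - s))"
    unfolding mult.assoc[of 2 l] by (rule mult_left_mono[OF 1]) simp
  finally show ?thesis by simp
qed

lemma cont_h_seg: "b < 1 \<Longrightarrow> continuous_on {0..b} (\<lambda>s. h (seg s))"
  by (intro continuous_at_imp_continuous_on ballI has_vector_derivative_continuous[OF h_seg_deriv]) auto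

text \<open>The derivative of exp h along the segment is at most 2 B / (1 - s), which integrates to
  a logarithm: the Lipschitz property of exp h in the hyperbolic metric.\<close>

lemma exp_h_seg:
  assumes s: "0 \<le> s" "s < 1"
  shows "cmod (exp (h (seg s)) - exp (h z0)) \<le> 2 * B * ln (1 / (1 - s))"
proof (cases "s = 0")
  case False
  then have s0: "0 < s" using s by simp
  have "cmod (exp (h (seg s)) - exp (h (seg 0))) \<le> - 2 * B * ln (1 - s) - (- 2 * B * ln (1 - 0))"
  proof (rule differentiable_bound_general[OF s0])
    show "continuous_on {0..s} (\<lambda>s. exp (h (seg s)))"
      using cont_h_seg[OF s(2)] by (intro continuous_intros)
    show "continuous_on {0..s} (\<lambda>x. - 2 * B * ln (1 - x))"
      using s by (intro continuous_intros) auto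
    fix x assume x: "0 < x" "x < s"
    show "((\<lambda>s. exp (h (seg s))) has_vector_derivative (p - z0) * h' (seg x) * exp (h (seg x))) (at x)"
      using field_vector_diff_chain_at[OF h_seg_deriv DERIV_exp, of x] x s by (simp add: o_def)
    show "((\<lambda>x. - 2 * B * ln (1 - x)) has_vector_derivative 2 * B / (1 - x)) (at x)"
      using x s by (auto intro!: derivative_eq_intros simp: has_real_derivative_iff_has_vector_derivative[symmetric])
    show "cmod ((p - z0) * h' (seg x) * exp (h (seg x))) \<le> 2 * B / (1 - x)"
      using h_seg_deriv_bound[of x] x s by (simp add: norm_mult)
  qed
  then show ?thesis using s by (simp add: ln_div)
qed simp

text \<open>The coefficient of (1 - s)^(-3/2) in the bound for the derivative of h along the
  segment: 2 B / (1 - s) from \<open>h_seg_deriv_bound\<close>, times the bound for exp (- Re h) in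
  \<open>exp_neg_h_seg\<close>.\<close>

definition M0 :: real where "M0 = 2 * B * (1 + 4 * B) * exp (- Re (h z0))"

text \<open>Nonnegativity of Re h turns the additive logarithmic bound for exp h into a factor 1 +
  k. Replacing the logarithm by (1 - s)^(-1/2) leaves (1 - s)^(-3/2) for h', which is still finite
  after two integrations.\<close>

lemma exp_neg_h_seg:
  assumes s: "0 \<le> s" "s < 1"
  shows "exp (- Re (h (seg s))) \<le> (1 + 4 * B) / sqrt (1 - s) * exp (- Re (h z0))"
proof -
  define k where "k = 2 * B * ln (1 / (1 - s))"
  have k: "0 \<le> k" using B_nonneg s by (simp add: k_def)
  have "exp (Re (h z0)) - exp (Re (h (seg s))) \<le> cmod (exp (h (seg s)) - exp (h z0))"
    using norm_triangle_ineq2[of "exp (h z0)" "exp (h (seg s))"] by (simp add: norm_minus_commute)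
  then have "exp (Re (h z0)) \<le> exp (Re (h (seg s))) + k"
    using exp_h_seg[OF s] by (simp add: k_def)
  also have "\<dots> \<le> exp (Re (h (seg s))) * (1 + k)"
    using k nonneg[OF Im_seg_pos[OF s]] by (simp add: algebra_simps mult_le_cancel_left1)
  finally have "exp (- Re (h (seg s))) \<le> (1 + k) * exp (- Re (h z0))"
    by (simp add: exp_minus field_simps)
  also have "\<dots> \<le> (1 + 4 * B) / sqrt (1 - s) * exp (- Re (h z0))"
  proof (rule mult_right_mono)
    define y where "y = 1 / sqrt (1 - s)"
    have y: "1 \<le> y" using s by (simp add: y_def)
    have "ln (1 / (1 - s)) = 2 * ln y" using s by (simp add: y_def ln_div ln_sqrt)
    moreover have "ln y \<le> y - 1" using y by (intro ln_le_minus_one) auto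
    ultimately have "ln (1 / (1 - s)) \<le> 2 * y" by linarith
    then have "k \<le> 2 * B * (2 * y)" unfolding k_def using B_nonneg by (intro mult_left_mono) auto
    then have "1 + k \<le> (1 + 4 * B) * y" using y by (simp add: algebra_simps)
    then show "1 + k \<le> (1 + 4 * B) / sqrt (1 - s)" by (simp add: y_def)
  qed simp
  finally show ?thesis .
qed

lemma h_seg_diff:
  assumes s: "0 \<le> s" "s < 1"
  shows "cmod (h (seg s) - h z0) \<le> 2 * M0 / sqrt (1 - s)"
proof (cases "s = 0")
  case True
  then show ?thesis using B_nonneg by (simp add: M0_def)
next
  case False
  then have s0: "0 < s" using s by simp
  have "cmod (h (seg s) - h (seg 0)) \<le> 2 * M0 / sqrt (1 - s) - 2 * M0 / sqrt (1 - 0)"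
  proof (rule differentiable_bound_general[OF s0 cont_h_seg[OF s(2)]])
    show "continuous_on {0..s} (\<lambda>x. 2 * M0 / sqrt (1 - x))"
      using s by (intro continuous_intros) auto
    fix x assume x: "0 < x" "x < s"
    show "((\<lambda>s. h (seg s)) has_vector_derivative (p - z0) * h' (seg x)) (at x)"
      using h_seg_deriv x s by simp
    have "((\<lambda>x. 2 * M0 / sqrt (1 - x)) has_real_derivative M0 / ((1 - x) * sqrt (1 - x))) (at x)"
      using x s by (auto intro!: derivative_eq_intros simp: field_simps)
    then show "((\<lambda>x. 2 * M0 / sqrt (1 - x)) has_vector_derivative M0 / ((1 - x) * sqrt (1 - x))) (at x)"
      by (simp add: has_real_derivative_iff_has_vector_derivative)
    have x1: "0 \<le> x" "x < 1" using x s by auto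
    have "cmod ((p - z0) * h' (seg x))
        = cmod ((p - z0) * h' (seg x)) * exp (Re (h (seg x))) * exp (- Re (h (seg x)))"
      by (simp add: exp_minus)
    also have "\<dots> \<le> 2 * B / (1 - x) * ((1 + 4 * B) / sqrt (1 - x) * exp (- Re (h z0)))"
      using h_seg_deriv_bound[OF x1] exp_neg_h_seg[OF x1] B_nonneg x1 by (intro mult_mono) auto
    also have "\<dots> = M0 / ((1 - x) * sqrt (1 - x))" by (simp add: M0_def)
    finally show "cmod ((p - z0) * h' (seg x)) \<le> M0 / ((1 - x) * sqrt (1 - x))" .
  qed
  moreover have "0 \<le> M0" using B_nonneg by (simp add: M0_def)
  ultimately show ?thesis by simp
qed

text \<open>The integrand is bounded by 4 l M0 (1 - s)^(-1/2), whose integral is 8 l M0. The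
  constant is independent of Im p and therefore survives the passage to the boundary.\<close>

lemma primitive_taylor:
  assumes \<Psi>: "\<And>w. 0 < Im w \<Longrightarrow> (\<Psi> has_field_derivative h w) (at w)" and p0: "0 < Im p"
  shows "cmod (\<Psi> p - \<Psi> z0 - (p - z0) * h z0) \<le> 16 * B * (1 + 4 * B) * l * exp (- Re (h z0))"
proof -
  have pos: "0 < Im (seg s)" if "s \<in> {0..1}" for s
    using Im_seg_pos[of s] that p0 by (cases "s = 1") auto
  have d: "((\<lambda>s. \<Psi> (seg s) - of_real s * ((p - z0) * h z0)) has_vector_derivative
        (p - z0) * h (seg x) - (p - z0) * h z0) (at x)" if "x \<in> {0..1}" for x
    using field_vector_diff_chain_at[OF seg_deriv \<Psi>[OF pos[OF that]]]
    by (auto intro!: derivative_eq_intros has_vector_derivative_real_field simp: o_def)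
  \<comment> \<open>The comparison function is continuous at 1, although its derivative may blow up
    there; the mean value inequality needs derivatives only in the interior.\<close>
  have "cmod ((\<Psi> (seg 1) - of_real 1 * ((p - z0) * h z0)) - (\<Psi> (seg 0) - of_real 0 * ((p - z0) * h z0)))
     \<le> - 8 * l * M0 * sqrt (1 - 1) - (- 8 * l * M0 * sqrt (1 - 0))"
  proof (rule differentiable_bound_general)
    show "continuous_on {0..1} (\<lambda>s. \<Psi> (seg s) - of_real s * ((p - z0) * h z0))"
      by (intro continuous_at_imp_continuous_on ballI has_vector_derivative_continuous[OF d])
    show "continuous_on {0..1} (\<lambda>x. - 8 * l * M0 * sqrt (1 - x))"
      by (intro continuous_intros)
    fix x :: real assume x: "0 < x" "x < 1"
    show "((\<lambda>s. \<Psi> (seg s) - of_real s * ((p - z0) * h z0)) has_vector_derivative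
        (p - z0) * h (seg x) - (p - z0) * h z0) (at x)"
      using d x by auto
    have "((\<lambda>x. - 8 * l * M0 * sqrt (1 - x)) has_real_derivative 4 * l * M0 / sqrt (1 - x)) (at x)"
      using x by (auto intro!: derivative_eq_intros simp: field_simps)
    then show "((\<lambda>x. - 8 * l * M0 * sqrt (1 - x)) has_vector_derivative 4 * l * M0 / sqrt (1 - x)) (at x)"
      by (simp add: has_real_derivative_iff_has_vector_derivative)
    have "cmod ((p - z0) * h (seg x) - (p - z0) * h z0) = cmod (p - z0) * cmod (h (seg x) - h z0)"
      by (simp flip: norm_mult add: right_diff_distrib)
    also have "\<dots> \<le> 2 * l * (2 * M0 / sqrt (1 - x))"
      using h_seg_diff[of x] x p z0 by (intro mult_mono) auto
    finally show "cmod ((p - z0) * h (seg x) - (p - z0) * h z0) \<le> 4 * l * M0 / sqrt (1 - x)"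
      by (simp add: mult_ac)
  qed simp
  then show ?thesis by (simp add: M0_def mult_ac diff_diff_eq add.commute)
qed

end

end

section \<open>Arcs and measures on the circle\<close>

lemma circ_add: "circ (x + y) = circ x * circ y"
  by (simp add: circ_def ring_distribs exp_add)

lemma circ_eq_cis: "circ t = cis (2 * pi * t)"
  by (simp add: circ_def cis_conv_exp mult_ac)

lemma norm_circ [simp]: "cmod (circ t) = 1"
  by (simp add: circ_eq_cis)

lemma circ_nonzero [simp]: "circ t \<noteq> 0"
  using norm_circ[of t] by (metis norm_zero zero_neq_one)

lemma circ_eq_iff: "circ x = circ y \<longleftrightarrow> x - y \<in> \<int>"
proof -
  have "circ x = circ y \<longleftrightarrow> circ (x - y) = 1"
    using circ_add[of "x - y" y] by simp
  also have "\<dots> \<longleftrightarrow> (\<exists>n::int. 2 * pi * (x - y) = of_int (2 * n) * pi)"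
    unfolding circ_def by (subst exp_eq_1) (auto simp: mult_ac)
  also have "\<dots> \<longleftrightarrow> x - y \<in> \<int>"
  proof
    assume "\<exists>n::int. 2 * pi * (x - y) = of_int (2 * n) * pi"
    then obtain n :: int where "x - y = of_int n" by auto
    then show "x - y \<in> \<int>" by simp
  next
    assume "x - y \<in> \<int>"
    then obtain n :: int where "x - y = of_int n" by (auto elim: Ints_cases)
    then show "\<exists>n::int. 2 * pi * (x - y) = of_int (2 * n) * pi" by (intro exI[of _ n]) simp
  qed
  finally show ?thesis .
qed

lemma circ_inj:
  assumes "circ x = circ y" "\<bar>x - y\<bar> < 1"
  shows "x = y"
proof -
  obtain n :: int where n: "x - y = of_int n" using assms(1) by (auto simp: circ_eq_iff elim: Ints_cases)
  then have "n = 0" using assms(2) by simp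
  then show ?thesis using n by simp
qed

lemma sphere_circ_ex:
  assumes "cmod \<zeta> = 1"
  obtains t where "a \<le> t" "t < a + 1" "\<zeta> = circ t"
proof -
  obtain x where "\<zeta> = cis x"
    using assms by (metis cis_Arg_unique complex_norm_eq_1_exp_eq cis_conv_exp rcis_cmod_Arg rcis_def mult_1 of_real_1)
  then have x: "\<zeta> = circ (x / (2 * pi))" by (simp add: circ_eq_cis)
  define t where "t = a + frac (x / (2 * pi) - a)"
  have "circ t = circ (x / (2 * pi))"
    unfolding circ_eq_iff t_def frac_def by (simp add: algebra_simps)
  then show ?thesis using x that[of t] frac_lt_1[of "x / (2 * pi) - a"] by (auto simp: t_def)
qed

lemma circ_vector_derivative: "(circ has_vector_derivative 2 * pi * \<i> * circ t) (at t within S)"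
  unfolding circ_def
  by (auto intro!: derivative_eq_intros has_vector_derivative_real_field)

lemma continuous_on_circ [continuous_intros]:
  "continuous_on S f \<Longrightarrow> continuous_on S (\<lambda>x. circ (f x))"
  unfolding circ_def by (intro continuous_intros)

lemma circ_measurable [measurable]: "circ \<in> borel_measurable borel"
  by (intro borel_measurable_continuous_onI continuous_intros)

text \<open>A half-open arc is a countable union of compact arcs. This makes arcs Borel, and with
  rational endpoints it gives joint measurability in the endpoint and the point as well.\<close>

lemma circ_image_half_open:
  "circ ` {a..<s} = (\<Union>q\<in>{q\<in>\<rat>. q < s}. circ ` {a..q})"
proof (intro equalityI subsetI)
  fix \<zeta> assume "\<zeta> \<in> circ ` {a..<s}"
  then obtain t where t: "a \<le> t" "t < s" "\<zeta> = circ t" by auto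
  then obtain q where "q \<in> \<rat>" "t < q" "q < s" using Rats_dense_in_real by blast
  then show "\<zeta> \<in> (\<Union>q\<in>{q\<in>\<rat>. q < s}. circ ` {a..q})" using t by force
qed auto

lemma closed_circ_image: "closed (circ ` {a..b})"
  by (intro compact_imp_closed compact_continuous_image continuous_intros) auto

lemma countable_Rats_less: "countable {q\<in>\<rat>. q < (s::real)}"
  by (rule countable_subset[OF _ countable_rat]) auto

lemma arc_measurable [measurable]: "arc a l \<in> sets borel"
  unfolding arc_def circ_image_half_open
  by (intro sets.countable_UN'' countable_Rats_less borel_closed closed_circ_image)

text \<open>Needed for Fubini in \<open>integral_by_parts\<close>, where the endpoint of the arc is
  a variable of integration.\<close>

lemma arc_pairs_measurable:
  "{(s, \<zeta>). \<zeta> \<in> circ ` {a..<b + s}} \<in> sets (borel \<Otimes>\<^sub>M borel)"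
proof -
  have "{(s, \<zeta>). \<zeta> \<in> circ ` {a..<b + s}} = (\<Union>q\<in>\<rat>. {q - b<..} \<times> circ ` {a..q})"
    unfolding circ_image_half_open by (auto simp: algebra_simps)
  also have "\<dots> \<in> sets (borel \<Otimes>\<^sub>M borel)"
    by (intro sets.countable_UN'' countable_rat pair_measureI borel_open open_greaterThan
        borel_closed[OF closed_circ_image])
  finally show ?thesis .
qed

lemma arc_split:
  assumes "0 \<le> l" "0 \<le> m"
  shows "arc a (l + m) = arc a l \<union> arc (a + l) m"
proof -
  have "{a..<a + (l + m)} = {a..<a + l} \<union> {a + l..<a + l + m}" using assms by auto
  then show ?thesis by (simp add: arc_def image_Un)
qed

lemma arc_disjoint:
  assumes "0 \<le> l" "0 \<le> m" "l + m \<le> 1"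
  shows "arc a l \<inter> arc (a + l) m = {}"
proof -
  have "circ x \<noteq> circ y" if "x \<in> {a..<a + l}" "y \<in> {a + l..<a + l + m}" for x y
    using circ_inj[of x y] that assms by fastforce
  then show ?thesis by (fastforce simp: arc_def)
qed

lemma arc_full: "arc a 1 = sphere 0 1"
proof (intro equalityI subsetI)
  fix \<zeta> :: complex assume "\<zeta> \<in> sphere 0 1"
  then obtain t where "a \<le> t" "t < a + 1" "\<zeta> = circ t" using sphere_circ_ex[of \<zeta> a] by auto
  then show "\<zeta> \<in> arc a 1" by (simp add: arc_def)
qed (auto simp: arc_def)

locale circle_measure = finite_measure \<nu> for \<nu> :: "complex measure" +
  assumes sets_nu [measurable_cong]: "sets \<nu> = sets borel"
    and null_nu: "emeasure \<nu> (- sphere 0 1) = 0"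
begin

lemma space_nu [simp]: "space \<nu> = UNIV"
  using sets_eq_imp_space_eq[OF sets_nu] by simp

lemma AE_sphere: "AE \<zeta> in \<nu>. cmod \<zeta> = 1"
proof (rule AE_I[OF _ null_nu])
  show "- sphere 0 1 \<in> sets \<nu>" by (simp add: sets_nu)
qed auto

abbreviation mass :: real where "mass \<equiv> measure \<nu> UNIV"

lemma measure_arc_full: "measure \<nu> (arc a 1) = mass"
proof -
  have "measure \<nu> (sphere 0 1) = measure \<nu> UNIV"
    using AE_sphere by (intro finite_measure_eq_AE) (auto simp: sets_nu)
  then show ?thesis by (simp add: arc_full)
qed

lemma measure_arc_split:
  assumes "0 \<le> l" "0 \<le> m" "l + m \<le> 1"
  shows "measure \<nu> (arc a (l + m)) = measure \<nu> (arc a l) + measure \<nu> (arc (a + l) m)"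
  unfolding arc_split[OF assms(1,2)]
  by (rule finite_measure_Union) (auto simp: sets_nu arc_disjoint[OF assms])

lemma measure_arc_le: "measure \<nu> (arc a l) \<le> mass"
  using bounded_measure by simp

text \<open>Fubini between nu and a gauge integral over an interval, by cutting g off outside the
  interval. It serves the integration by parts and the boundary limit of the Poisson
  integral.\<close>

lemma integral_swap_interval:
  fixes g :: "real \<Rightarrow> complex \<Rightarrow> 'b :: euclidean_space"
  assumes meas: "case_prod g \<in> borel_measurable (borel \<Otimes>\<^sub>M borel)"
    and bound: "\<And>x \<zeta>. x \<in> {b..c} \<Longrightarrow> norm (g x \<zeta>) \<le> K"
  shows "(\<integral>\<zeta>. integral {b..c} (\<lambda>x. g x \<zeta>) \<partial>\<nu>) = integral {b..c} (\<lambda>x. \<integral>\<zeta>. g x \<zeta> \<partial>\<nu>)"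
    and "(\<lambda>\<zeta>. integral {b..c} (\<lambda>x. g x \<zeta>)) \<in> borel_measurable borel"
proof -
  interpret P: pair_sigma_finite lborel \<nu> ..
  define k where "k = (\<lambda>x \<zeta>. indicator {b..c} x *\<^sub>R g x \<zeta>)"
  note [measurable] = meas
  have kmeas [measurable]: "case_prod k \<in> borel_measurable (borel \<Otimes>\<^sub>M borel)"
    unfolding k_def by measurable
  have int: "integrable (lborel \<Otimes>\<^sub>M \<nu>) (case_prod k)"
  proof (rule integrableI_bounded_set[where A = "{b..c} \<times> UNIV" and B = K])
    show "{b..c} \<times> UNIV \<in> sets (lborel \<Otimes>\<^sub>M \<nu>)" by (auto simp: sets_nu intro!: pair_measureI)
    show "case_prod k \<in> borel_measurable (lborel \<Otimes>\<^sub>M \<nu>)" by measurable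
    have "emeasure (lborel \<Otimes>\<^sub>M \<nu>) ({b..c} \<times> UNIV) = emeasure lborel {b..c} * emeasure \<nu> UNIV"
      by (intro emeasure_pair_measure_Times) (auto simp: sets_nu)
    also have "\<dots> < \<infinity>"
      by (cases "b \<le> c") (auto simp: ennreal_mult_less_top emeasure_eq_measure)
    finally show "emeasure (lborel \<Otimes>\<^sub>M \<nu>) ({b..c} \<times> UNIV) < \<infinity>" .
  qed (auto simp: k_def bound indicator_def intro!: AE_I2)
  have set_eq: "(\<integral>x. k x \<zeta> \<partial>lborel) = integral {b..c} (\<lambda>x. g x \<zeta>)" for \<zeta>
  proof -
    have "set_integrable lborel {b..c} (\<lambda>x. g x \<zeta>)"
      unfolding set_integrable_def
      by (rule integrableI_bounded_set[where A = "{b..c}" and B = K])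
        (auto simp: bound emeasure_lborel_Icc_eq split: split_indicator)
    from set_borel_integral_eq_integral(2)[OF this] show ?thesis
      by (simp add: k_def set_lebesgue_integral_def)
  qed
  have k2: "(\<integral>\<zeta>. k x \<zeta> \<partial>\<nu>) = indicator {b..c} x *\<^sub>R (\<integral>\<zeta>. g x \<zeta> \<partial>\<nu>)" for x
    by (simp add: k_def)
  have "set_integrable lborel {b..c} (\<lambda>x. \<integral>\<zeta>. g x \<zeta> \<partial>\<nu>)"
    unfolding set_integrable_def using P.integrable_fst[OF int] by (simp add: k2)
  from set_borel_integral_eq_integral(2)[OF this]
  have eq2: "(\<integral>x. (\<integral>\<zeta>. k x \<zeta> \<partial>\<nu>) \<partial>lborel) = integral {b..c} (\<lambda>x. \<integral>\<zeta>. g x \<zeta> \<partial>\<nu>)"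
    by (simp add: k2 set_lebesgue_integral_def)
  show "(\<integral>\<zeta>. integral {b..c} (\<lambda>x. g x \<zeta>) \<partial>\<nu>) = integral {b..c} (\<lambda>x. \<integral>\<zeta>. g x \<zeta> \<partial>\<nu>)"
    using P.Fubini_integral[OF int] unfolding set_eq eq2 .
  have "(\<lambda>\<zeta>. \<integral>x. k x \<zeta> \<partial>lborel) \<in> borel_measurable borel"
    by measurable
  then show "(\<lambda>\<zeta>. integral {b..c} (\<lambda>x. g x \<zeta>)) \<in> borel_measurable borel"
    unfolding set_eq .
qed

text \<open>For zeta = circ (\<theta> + t) the difference \<phi> (1/2) - \<phi> t is the integral of
  \<phi>' over those s with t < s, that is, those for which zeta lies in the arc from \<theta> - 1/2
  to \<theta> + s. Fubini turns this indicator into the mass of the arc.\<close>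

lemma integral_by_parts:
  fixes \<phi> \<phi>' :: "real \<Rightarrow> complex"
  assumes der: "\<And>t. (\<phi> has_vector_derivative \<phi>' t) (at t)" and cont: "continuous_on UNIV \<phi>'"
    and \<Phi>: "\<And>t. \<Phi> (circ (\<theta> + t)) = \<phi> t" and meas: "\<Phi> \<in> borel_measurable borel"
  shows "(\<integral>\<zeta>. \<Phi> \<zeta> \<partial>\<nu>) = \<phi> (1/2) * mass -
    integral {-1/2..1/2} (\<lambda>s. \<phi>' s * measure \<nu> (arc (\<theta> - 1/2) (s + 1/2)))"
proof -
  define g where "g = (\<lambda>s \<zeta>. indicator {(s, \<zeta>). \<zeta> \<in> circ ` {\<theta> - 1/2..<\<theta> + s}} (s, \<zeta>) *\<^sub>R \<phi>' s)"
  obtain K where K: "\<And>s. s \<in> {-1/2..1/2} \<Longrightarrow> norm (\<phi>' s) \<le> K"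
    using compact_imp_bounded[OF compact_continuous_image[OF continuous_on_subset[OF cont] compact_Icc]]
    by (metis UNIV_I bounded_iff imageI subsetI)
  have K0: "0 \<le> K" using order.trans[OF norm_ge_zero K[of 0]] by simp
  have \<phi>'m: "\<phi>' \<in> borel_measurable borel" using cont by (rule borel_measurable_continuous_onI)
  have gm: "case_prod g \<in> borel_measurable (borel \<Otimes>\<^sub>M borel)"
    unfolding g_def using \<phi>'m arc_pairs_measurable[of "\<theta> - 1/2" \<theta>]
    by (auto intro!: borel_measurable_scaleR borel_measurable_indicator simp: case_prod_unfold)
  note swap = integral_swap_interval[OF gm, of "-1/2" "1/2" K]
  have gb: "norm (g x \<zeta>) \<le> K" if "x \<in> {-1/2..1/2}" for x \<zeta>
    using K[OF that] K0 by (auto simp: g_def split: split_indicator)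
  have inner: "integral {-1/2..1/2} (\<lambda>s. g s \<zeta>) = \<phi> (1/2) - \<Phi> \<zeta>" if \<zeta>1: "cmod \<zeta> = 1" for \<zeta>
  proof -
    obtain u where u: "\<theta> - 1/2 \<le> u" "u < \<theta> - 1/2 + 1" "\<zeta> = circ u"
      by (rule sphere_circ_ex[OF \<zeta>1])
    define t where "t = u - \<theta>"
    have t: "-1/2 \<le> t" "t < 1/2" "\<zeta> = circ (\<theta> + t)" using u by (auto simp: t_def)
    have "\<zeta> \<in> circ ` {\<theta> - 1/2..<\<theta> + s} \<longleftrightarrow> t < s" if "s \<in> {-1/2..1/2}" for s
    proof
      assume "\<zeta> \<in> circ ` {\<theta> - 1/2..<\<theta> + s}"
      then obtain v where v: "\<theta> - 1/2 \<le> v" "v < \<theta> + s" "circ (\<theta> + t) = circ v" using t by auto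
      have "\<theta> + t = v" by (rule circ_inj[OF v(3)]) (use v t that in auto)
      then show "t < s" using v by simp
    qed (use t in auto)
    \<comment> \<open>The arcs are half-open, so the condition is t < s; the closed interval differs
      from it only at s = t.\<close>
    then have "integral {-1/2..1/2} (\<lambda>s. g s \<zeta>)
        = integral {-1/2..1/2} (\<lambda>s. if s \<in> {t..1/2} then \<phi>' s else 0)"
      using t by (intro integral_spike[of "{t}"]) (auto simp: g_def split: split_indicator)
    also have "\<dots> = integral {t..1/2} \<phi>'"
    proof -
      have "{t..1/2} \<inter> {-1/2..1/2} = {t..1/2}" using t by auto
      then show ?thesis by (simp only: integral_restrict_Int)
    qed
    also have "\<dots> = \<phi> (1/2) - \<phi> t"
      using t by (intro integral_unique fundamental_theorem_of_calculus has_vector_derivative_at_within[OF der]) auto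
    finally show ?thesis using \<Phi>[of t] t by simp
  qed
  have outer: "(\<integral>\<zeta>. g s \<zeta> \<partial>\<nu>) = \<phi>' s * measure \<nu> (arc (\<theta> - 1/2) (s + 1/2))" for s
  proof -
    have "(\<integral>\<zeta>. g s \<zeta> \<partial>\<nu>) = (\<integral>\<zeta>. indicator (arc (\<theta> - 1/2) (s + 1/2)) \<zeta> *\<^sub>R \<phi>' s \<partial>\<nu>)"
      by (intro Bochner_Integration.integral_cong) (auto simp: g_def arc_def indicator_def)
    also have "\<dots> = measure \<nu> (arc (\<theta> - 1/2) (s + 1/2)) *\<^sub>R \<phi>' s"
      by (subst integral_scaleR_left) (auto simp: sets_nu emeasure_eq_measure)
    finally show ?thesis by (simp add: scaleR_conv_of_real mult.commute)
  qed
  define G where "G = (\<lambda>\<zeta>. integral {-1/2..1/2} (\<lambda>s. g s \<zeta>))"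
  have Gm: "G \<in> borel_measurable borel" unfolding G_def by (rule swap(2)[OF gb])
  have Gb: "AE \<zeta> in \<nu>. G \<zeta> = \<phi> (1/2) - \<Phi> \<zeta>"
    using AE_sphere inner by (auto simp: G_def)
  have Gint: "integrable \<nu> G"
  proof (rule integrable_const_bound)
    show "AE \<zeta> in \<nu>. norm (G \<zeta>) \<le> K"
    proof (rule AE_I2)
      fix \<zeta>
      show "norm (G \<zeta>) \<le> K"
      \<comment> \<open>For arbitrary zeta integrability in s is not known; without it the integral
        is 0 by default. Otherwise the interval of length 1 gives K.\<close>
      proof (cases "(\<lambda>s. g s \<zeta>) integrable_on {-1/2..1/2}")
        case True
        then have "norm (G \<zeta>) \<le> integral {-1/2..1/2} (\<lambda>s::real. K)"
          unfolding G_def by (intro integral_norm_bound_integral gb) auto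
        then show ?thesis by simp
      qed (simp add: G_def not_integrable_integral K0)
    qed
  qed (use Gm in simp)
  have "(\<integral>\<zeta>. \<Phi> \<zeta> \<partial>\<nu>) = (\<integral>\<zeta>. \<phi> (1/2) - G \<zeta> \<partial>\<nu>)"
    using Gb meas Gm by (intro integral_cong_AE) auto
  also have "\<dots> = \<phi> (1/2) * mass - (\<integral>\<zeta>. G \<zeta> \<partial>\<nu>)"
    using Gint by (simp add: scaleR_conv_of_real mult.commute)
  also have "(\<integral>\<zeta>. G \<zeta> \<partial>\<nu>) = integral {-1/2..1/2} (\<lambda>s. \<integral>\<zeta>. g s \<zeta> \<partial>\<nu>)"
    unfolding G_def by (rule swap(1)[OF gb])
  also have "\<dots> = integral {-1/2..1/2} (\<lambda>s. \<phi>' s * measure \<nu> (arc (\<theta> - 1/2) (s + 1/2)))"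
    by (simp only: outer)
  finally show ?thesis .
qed

end

lemma has_integral_rpow_tail:
  fixes d :: real assumes d: "0 < d"
  shows "((\<lambda>t. 1 / ((d + t) * sqrt (d + t))) has_integral 2 / sqrt d - 2 / sqrt (d + 1/2)) {0..1/2}"
proof -
  have "((\<lambda>t. 1 / ((d + t) * sqrt (d + t))) has_integral
     - (2 / sqrt (d + 1/2)) - - (2 / sqrt (d + 0))) {0..1/2}"
  proof (rule fundamental_theorem_of_calculus)
    fix t :: real assume "t \<in> {0..1/2}"
    then show "((\<lambda>t. - (2 / sqrt (d + t))) has_vector_derivative 1 / ((d + t) * sqrt (d + t)))
        (at t within {0..1/2})"
      unfolding has_real_derivative_iff_has_vector_derivative[symmetric] using d
      by (auto intro!: derivative_eq_intros simp: field_simps)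
  qed simp
  then show ?thesis by simp
qed

text \<open>The exponent 3/2 is what remains of the cubic decay of a kernel derivative after the
  growth (d + |t|)^(3/2) of the deviation from the linear approximation.\<close>

lemma norm_integral_le_of_rpow_tail:
  fixes f :: "real \<Rightarrow> complex"
  assumes d: "0 < d" and K: "0 \<le> K" and f: "continuous_on {-1/2..1/2} f"
    and bound: "\<And>t. t \<in> {-1/2..1/2} \<Longrightarrow> cmod (f t) \<le> K * (1 / ((d + \<bar>t\<bar>) * sqrt (d + \<bar>t\<bar>)))"
  shows "cmod (integral {-1/2..1/2} f) \<le> 4 * K / sqrt d"
proof -
  define I where "I = 2 / sqrt d - 2 / sqrt (d + 1/2)"
  have I: "I \<le> 2 / sqrt d" using d by (simp add: I_def)
  have h: "((\<lambda>t. K * (1 / ((d + t) * sqrt (d + t)))) has_integral K * I) {0..1/2}"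
    unfolding I_def by (intro has_integral_mult_right has_integral_rpow_tail d)
  have int: "f integrable_on {-1/2..1/2}" using f by (rule integrable_continuous_interval)
  have int1: "f integrable_on {0..1/2}" "f integrable_on {-1/2..0}"
    using integrable_subinterval_real[OF int] by auto
  have b1: "cmod (integral {0..1/2} f) \<le> K * I"
  proof (rule integral_norm_bound_integral[OF int1(1) has_integral_integrable[OF h], unfolded integral_unique[OF h]])
    fix x :: real assume "x \<in> {0..1/2}"
    then show "cmod (f x) \<le> K * (1 / ((d + x) * sqrt (d + x)))" using bound[of x] by simp
  qed
  have h': "((\<lambda>t. K * (1 / ((d + - t) * sqrt (d + - t)))) has_integral K * I) {-(1/2)..-0}"
    by (rule has_integral_reflect_lemma_real[OF h])
  have b2: "cmod (integral {-1/2..0} f) \<le> K * I"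
  proof -
    have "cmod (f x) \<le> K * (1 / ((d + - x) * sqrt (d + - x)))" if "x \<in> {-(1/2)..-0}" for x
      using bound[of x] that by simp
    with integral_norm_bound_integral[OF _ has_integral_integrable[OF h'], unfolded integral_unique[OF h'], of f]
    show ?thesis using int1(2) by simp
  qed
  have "integral {-1/2..1/2} f = integral {-1/2..0} f + integral {0..1/2} f"
    by (rule Henstock_Kurzweil_Integration.integral_combine[symmetric]) (use int in auto)
  then have "cmod (integral {-1/2..1/2} f) \<le> K * I + K * I"
    using norm_triangle_mono[OF b2 b1] by (simp only:)
  also have "\<dots> \<le> 2 * (K * (2 / sqrt d))"
    using mult_left_mono[OF I K] by linarith
  finally show ?thesis by simp
qed

section \<open>Integrals of kernels under the arc condition\<close>

context circle_measure
begin

definition contiguous_arc_cond :: "real \<Rightarrow> bool" where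
  "contiguous_arc_cond C \<longleftrightarrow> (\<forall>a l. 0 < l \<and> l \<le> 1/2 \<longrightarrow>
       (\<forall>a'\<in>{a + l, a - l}.
          \<bar>measure \<nu> (arc a l) / l - measure \<nu> (arc a' l) / l\<bar>
            \<le> C * exp (- (measure \<nu> (arc a l) / l))))"

lemma contiguous_arc_condD:
  assumes "contiguous_arc_cond C" "0 < l" "l \<le> 1/2" "a' = a + l \<or> a' = a - l"
  shows "\<bar>measure \<nu> (arc a l) - measure \<nu> (arc a' l)\<bar> \<le> C * l * exp (- (measure \<nu> (arc a l) / l))"
proof -
  have "\<bar>measure \<nu> (arc a l) / l - measure \<nu> (arc a' l) / l\<bar> \<le> C * exp (- (measure \<nu> (arc a l) / l))"
    using assms unfolding contiguous_arc_cond_def by auto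
  then have "\<bar>measure \<nu> (arc a l) - measure \<nu> (arc a' l)\<bar> / l \<le> C * exp (- (measure \<nu> (arc a l) / l))"
    using assms by (simp add: abs_divide flip: diff_divide_distrib)
  then show ?thesis using assms by (simp add: divide_le_eq mult_ac)
qed

context
  fixes C :: real
  assumes C: "0 \<le> C" and cond: "contiguous_arc_cond C"
begin

text \<open>Here exp (...) \<le> 1 suffices: two adjacent arcs of length l differ in mass by at most
  C l, so halving an arc halves the bound on its mass up to that error. Masses are O(l log (1/l)),
  and there are no atoms.\<close>

lemma small_arc: "measure \<nu> (arc a (1 / 2 ^ k / 2)) \<le> (mass + C * k) / 2 ^ k"
proof (induction k arbitrary: a)
  case 0
  then show ?case using measure_arc_le by simp
next
  case (Suc k)
  define l :: real where "l = 1 / 2 ^ Suc k / 2"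
  have pk: "1 \<le> (2::real) ^ k" by simp
  have l: "0 < l" "l \<le> 1/2" "2 * l = 1 / 2 ^ k / 2"
    using pk one_le_power[of "2::real" "Suc k"] by (auto simp: l_def divide_simps)
  have "\<bar>measure \<nu> (arc a l) - measure \<nu> (arc (a + l) l)\<bar> \<le> C * l * exp (- (measure \<nu> (arc a l) / l))"
    using contiguous_arc_condD[OF cond l(1,2)] by simp
  also have "\<dots> \<le> C * l * 1"
    using C l by (intro mult_left_mono) auto
  finally have "\<bar>measure \<nu> (arc a l) - measure \<nu> (arc (a + l) l)\<bar> \<le> C * l" by simp
  moreover have "measure \<nu> (arc a (2 * l)) = measure \<nu> (arc a l) + measure \<nu> (arc (a + l) l)"
    using measure_arc_split[of l l a] l(1,2) unfolding mult_2 by linarith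
  ultimately have "2 * measure \<nu> (arc a l) \<le> measure \<nu> (arc a (2 * l)) + C * l" by simp
  also have "\<dots> \<le> (mass + C * k) / 2 ^ k + C * l"
    using Suc.IH[of a] unfolding l(3) by simp
  also have "C * l \<le> C * (1 / 2 ^ k)" using C pk by (intro mult_left_mono) (auto simp: l_def field_simps)
  finally show ?case unfolding l_def by (simp add: field_simps)
qed

lemma small_arcs:
  assumes "0 < e"
  obtains r where "0 < r" "\<And>a l. l \<le> r \<Longrightarrow> measure \<nu> (arc a l) < e"
proof -
  have "(\<lambda>k. (mass + C * real k) / 2 ^ k) \<longlonglongrightarrow> 0" by real_asymp
  then have "\<forall>\<^sub>F k in sequentially. (mass + C * real k) / 2 ^ k < e"
    using assms by (rule order_tendstoD)
  then obtain k where k: "(mass + C * real k) / 2 ^ k < e"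
    by (auto simp: eventually_sequentially)
  have "measure \<nu> (arc a l) < e" if "l \<le> 1 / 2 ^ k / 2" for a l
  proof -
    have "measure \<nu> (arc a l) \<le> measure \<nu> (arc a (1 / 2 ^ k / 2))"
      using that by (intro finite_measure_mono) (auto simp: arc_def sets_nu arc_measurable[unfolded arc_def] image_mono)
    then show ?thesis using small_arc[of a k] k by linarith
  qed
  then show ?thesis using that[of "1 / 2 ^ k / 2"] by simp
qed

context
  fixes \<theta> :: real
begin

text \<open>The base point is the antipode of \<theta>. The point of interest becomes t = 0, and the
  cut of the circle lies where the kernels centred near \<theta> are smallest.\<close>

definition distr_fun :: "real \<Rightarrow> real" where
  "distr_fun t = measure \<nu> (arc (\<theta> - 1/2) (t + 1/2))"

lemma distr_fun_diff:
  assumes "-1/2 \<le> s" "0 \<le> l" "s + l \<le> 1/2"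
  shows "distr_fun (s + l) - distr_fun s = measure \<nu> (arc (\<theta> + s) l)"
  using measure_arc_split[of "s + 1/2" l "\<theta> - 1/2"] assms by (simp add: distr_fun_def algebra_simps)

lemma distr_fun_mono: "mono_on {-(1/2)..1/2} distr_fun"
proof (rule mono_onI)
  fix r s :: real assume "r \<in> {-(1/2)..1/2}" "s \<in> {-(1/2)..1/2}" "r \<le> s"
  then show "distr_fun r \<le> distr_fun s"
    using distr_fun_diff[of r "s - r"] measure_nonneg[of \<nu> "arc (\<theta> + r) (s - r)"]
    by (simp del: measure_nonneg)
qed

lemma distr_fun_continuous: "continuous_on {-(1/2)..1/2} distr_fun"
  unfolding continuous_on_iff
proof (intro ballI allI impI)
  fix x e :: real assume x: "x \<in> {-(1/2)..1/2}" and e: "0 < e"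
  obtain r where r: "0 < r" "\<And>a l. l \<le> r \<Longrightarrow> measure \<nu> (arc a l) < e"
    using small_arcs[OF e] by blast
  have "dist (distr_fun x') (distr_fun x) < e" if "x' \<in> {-(1/2)..1/2}" "dist x' x < r" for x'
  proof (cases "x \<le> x'")
    case True
    then show ?thesis using distr_fun_diff[of x "x' - x"] that x r(2)[of "x' - x" "\<theta> + x"]
        measure_nonneg[of \<nu> "arc (\<theta> + x) (x' - x)"]
      by (simp add: dist_real_def del: measure_nonneg)
  next
    case False
    then show ?thesis using distr_fun_diff[of x' "x - x'"] that x r(2)[of "x - x'" "\<theta> + x'"]
        measure_nonneg[of \<nu> "arc (\<theta> + x') (x - x')"]
      by (simp add: dist_real_def del: measure_nonneg)
  qed
  then show "\<exists>d>0. \<forall>x'\<in>{-(1/2)..1/2}. dist x' x < d \<longrightarrow> dist (distr_fun x') (distr_fun x) < e"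
    using r(1) by blast
qed

lemma distr_fun_zygmund: "exp_zygmund C {-(1/2)..1/2} distr_fun"
  unfolding exp_zygmund_def
proof (intro allI impI)
  fix t l :: real assume l: "0 < l" and sub: "{t - l..t + l} \<subseteq> {-(1/2)..1/2}"
  have t: "- (1/2) \<le> t - l" "t + l \<le> 1/2" using sub l by auto
  have l2: "l \<le> 1/2" using t by simp
  have 1: "distr_fun (t + l) - distr_fun t = measure \<nu> (arc (\<theta> + t) l)"
    using distr_fun_diff[of t l] t l by simp
  have 2: "distr_fun t - distr_fun (t - l) = measure \<nu> (arc (\<theta> + (t - l)) l)"
    using distr_fun_diff[of "t - l" l] t l by simp
  have 3: "distr_fun (t + l) - 2 * distr_fun t + distr_fun (t - l)
      = measure \<nu> (arc (\<theta> + t) l) - measure \<nu> (arc (\<theta> + (t - l)) l)"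
    using 1 2 by simp
  show "\<bar>distr_fun (t + l) - 2 * distr_fun t + distr_fun (t - l)\<bar>
        \<le> C * l * exp (- ((distr_fun (t + l) - distr_fun t) / l)) \<and>
       \<bar>distr_fun (t + l) - 2 * distr_fun t + distr_fun (t - l)\<bar>
        \<le> C * l * exp (- ((distr_fun t - distr_fun (t - l)) / l))"
    unfolding 3 unfolding 1 2
    using contiguous_arc_condD[OF cond l l2, of "\<theta> + (t - l)" "\<theta> + t"]
      contiguous_arc_condD[OF cond l l2, of "\<theta> + t" "\<theta> + (t - l)"]
    by (auto simp: abs_minus_commute)
qed

text \<open>A measure with constant density A would give A m. Let E be the deviation of
  \<open>distr_fun\<close> from its line of slope A; integration by parts bounds the error by a
  boundary term, at most 2 \<kappa> K / d, and the integral of \<phi>' E, at most 4 \<kappa> K / d.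
  Cubic decay of \<phi>' beats the growth of E.\<close>

lemma kernel_estimate:
  fixes \<phi> \<phi>' :: "real \<Rightarrow> complex"
  assumes d: "0 < d" "d \<le> 1/2"
    and der: "\<And>t. (\<phi> has_vector_derivative \<phi>' t) (at t)" and cont: "continuous_on UNIV \<phi>'"
    and \<Phi>: "\<And>t. \<Phi> (circ (\<theta> + t)) = \<phi> t" and meas: "\<Phi> \<in> borel_measurable borel"
    and b: "\<And>t. \<bar>t\<bar> \<le> 1/2 \<Longrightarrow> cmod (\<phi>' t) \<le> \<kappa> / (d + \<bar>t\<bar>) ^ 3"
    and hend: "cmod (\<phi> (1/2)) \<le> \<kappa>"
    and mean: "(\<phi> has_integral m) {-1/2..1/2}"
  defines "A \<equiv> measure \<nu> (arc \<theta> d) / d"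
  shows "cmod ((\<integral>\<zeta>. \<Phi> \<zeta> \<partial>\<nu>) - A * m) \<le> 6 * \<kappa> * zyg_const2 C * exp (- A) / d"
proof -
  define E where "E = (\<lambda>t. distr_fun t - distr_fun 0 - A * t)"
  define K where "K = zyg_const2 C * exp (- A)"
  have K0: "0 \<le> K" using zyg_const2_ge[OF C] zyg_const_ge[OF C] C by (simp add: K_def)
  have \<kappa>0: "0 \<le> \<kappa>" using hend norm_ge_zero order.trans by blast
  have A: "A = (distr_fun d - distr_fun 0) / d"
    using distr_fun_diff[of 0 d] d by (simp add: A_def)
  have E: "\<bar>E t\<bar> \<le> K * ((d + \<bar>t\<bar>) * sqrt ((d + \<bar>t\<bar>) / d))" if "t \<in> {-(1/2)..1/2}" for t
    using exp_zygmund_linear_approx2[OF C d distr_fun_continuous distr_fun_mono distr_fun_zygmund that]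
    unfolding E_def K_def A by simp
  \<comment> \<open>At the cut d + |t| \<le> 1, so E is at most K / sqrt d there; this is weakened
    to K / d to match the other error term.\<close>
  have sd: "d \<le> sqrt d" using d real_le_rsqrt[of d d] by (simp add: power2_eq_square mult_left_le)
  have per: "\<phi> (- 1/2) = \<phi> (1/2)"
  proof -
    have "circ (\<theta> + - 1/2) = circ (\<theta> + 1/2)" by (subst circ_eq_iff) simp
    then show ?thesis using \<Phi>[of "-1/2"] \<Phi>[of "1/2"] by simp
  qed
  have Ehalf: "\<bar>E t\<bar> \<le> K / d" if "\<bar>t\<bar> = 1/2" for t
  proof -
    have "\<bar>E t\<bar> \<le> K * ((d + \<bar>t\<bar>) * sqrt ((d + \<bar>t\<bar>) / d))" using that by (intro E) (auto simp: abs_if split: if_splits)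
    also have "\<dots> \<le> K * (1 * (1 / sqrt d))"
      using d that K0 by (intro mult_left_mono mult_mono) (auto simp: real_sqrt_divide divide_right_mono)
    also have "\<dots> \<le> K * (1 / d)" using d sd K0 by (auto intro!: mult_left_mono divide_left_mono)
    finally show ?thesis by simp
  qed
  have cN: "continuous_on {-1/2..1/2} distr_fun" using distr_fun_continuous by simp
  have c': "continuous_on {-1/2..1/2} \<phi>'" using cont continuous_on_subset by blast
  have i1: "(\<phi>' has_integral 0) {-1/2..1/2}"
    using fundamental_theorem_of_calculus[of "-1/2" "1/2" \<phi> \<phi>'] der per
    by (auto intro: has_vector_derivative_at_within)
  have i2: "((\<lambda>t. of_real t * \<phi>' t) has_integral \<phi> (1/2) - m) {-1/2..1/2}"
  proof -
    have "((\<lambda>t. of_real t * \<phi>' t + \<phi> t) has_integral (of_real (1/2) * \<phi> (1/2) - of_real (-1/2) * \<phi> (-1/2))) {-1/2..1/2}"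
    proof (rule fundamental_theorem_of_calculus)
      fix t :: real
      have "((\<lambda>t. of_real t * \<phi> t) has_vector_derivative of_real t * \<phi>' t + \<phi> t) (at t)"
        by (auto intro!: derivative_eq_intros der has_vector_derivative_real_field)
      then show "((\<lambda>t. of_real t * \<phi> t) has_vector_derivative of_real t * \<phi>' t + \<phi> t) (at t within {-1/2..1/2})"
        by (rule has_vector_derivative_at_within)
    qed simp
    from has_integral_diff[OF this mean] show ?thesis using per by simp
  qed
  have i3: "((\<lambda>t. \<phi>' t * distr_fun t) has_integral integral {-1/2..1/2} (\<lambda>t. \<phi>' t * distr_fun t)) {-1/2..1/2}"
    by (intro integrable_integral integrable_continuous_interval continuous_intros c' cN)
  have "((\<lambda>t. \<phi>' t * distr_fun t - distr_fun 0 * \<phi>' t - A * (of_real t * \<phi>' t)) has_integral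
      integral {-1/2..1/2} (\<lambda>t. \<phi>' t * distr_fun t) - of_real (distr_fun 0) * 0 - A * (\<phi> (1/2) - m)) {-1/2..1/2}"
    by (intro has_integral_diff i3 has_integral_mult_right i1 i2)
  then have i4: "((\<lambda>t. \<phi>' t * E t) has_integral
      integral {-1/2..1/2} (\<lambda>t. \<phi>' t * distr_fun t) - A * (\<phi> (1/2) - m)) {-1/2..1/2}"
    by (simp add: E_def algebra_simps)
  have "(\<integral>\<zeta>. \<Phi> \<zeta> \<partial>\<nu>) = \<phi> (1/2) * mass - integral {-1/2..1/2} (\<lambda>t. \<phi>' t * distr_fun t)"
    unfolding distr_fun_def by (rule integral_by_parts[OF der cont \<Phi> meas])
  also have "integral {-1/2..1/2} (\<lambda>t. \<phi>' t * distr_fun t)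
      = integral {-1/2..1/2} (\<lambda>t. \<phi>' t * E t) + A * (\<phi> (1/2) - m)"
    using integral_unique[OF i4] by simp
  finally have "(\<integral>\<zeta>. \<Phi> \<zeta> \<partial>\<nu>) - A * m = \<phi> (1/2) * (mass - A) - integral {-1/2..1/2} (\<lambda>t. \<phi>' t * E t)"
    by (simp add: algebra_simps)
  \<comment> \<open>\<phi> is periodic but E is not: over a full turn \<open>distr_fun\<close> rises
    from 0 to \<open>mass\<close> while the line rises by A.\<close>
  also have "mass - A = E (1/2) - E (-1/2)"
    using measure_arc_full[of "\<theta> - 1/2"] by (simp add: E_def distr_fun_def) (simp add: arc_def)
  finally have "cmod ((\<integral>\<zeta>. \<Phi> \<zeta> \<partial>\<nu>) - A * m)
      \<le> cmod (\<phi> (1/2) * of_real (E (1/2) - E (-1/2))) + cmod (integral {-1/2..1/2} (\<lambda>t. \<phi>' t * E t))"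
    by (simp only: norm_triangle_ineq4)
  also have "cmod (\<phi> (1/2) * of_real (E (1/2) - E (-1/2))) \<le> \<kappa> * (2 * K / d)"
  proof -
    have "\<bar>E (1/2) - E (-1/2)\<bar> \<le> 2 * K / d" using Ehalf[of "1/2"] Ehalf[of "-1/2"] by simp
    then show ?thesis unfolding norm_mult norm_of_real using hend \<kappa>0 by (intro mult_mono) auto
  qed
  also have "cmod (integral {-1/2..1/2} (\<lambda>t. \<phi>' t * E t)) \<le> 4 * (\<kappa> * K / sqrt d) / sqrt d"
  proof (rule norm_integral_le_of_rpow_tail[OF d(1)])
    show "0 \<le> \<kappa> * K / sqrt d" using \<kappa>0 K0 d by simp
    show "continuous_on {-1/2..1/2} (\<lambda>t. \<phi>' t * E t)"
      unfolding E_def by (intro continuous_intros c' cN)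
    fix t :: real assume t: "t \<in> {-1/2..1/2}"
    define w where "w = d + \<bar>t\<bar>"
    have w: "0 < w" using d by (simp add: w_def)
    have "cmod (\<phi>' t * E t) \<le> \<kappa> / w ^ 3 * (K * (w * sqrt (w / d)))"
      unfolding norm_mult norm_of_real w_def using t \<kappa>0 K0 d b E
      by (intro mult_mono) auto
    also have "\<dots> = \<kappa> * K / sqrt d * (w * sqrt w / w ^ 3)"
      unfolding real_sqrt_divide times_divide_eq_left times_divide_eq_right divide_divide_eq_left
      by (simp only: mult_ac)
    also have "w * sqrt w / w ^ 3 = 1 / (w * sqrt w)"
    proof -
      have "w * sqrt w * (w * sqrt w) = w * w * (sqrt w * sqrt w)" by (simp only: mult_ac)
      then have "w * sqrt w * (w * sqrt w) = w ^ 3" using w by (simp add: power3_eq_cube)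
      then show ?thesis using w by (subst frac_eq_eq) auto
    qed
    finally show "cmod (\<phi>' t * E t) \<le> \<kappa> * K / sqrt d * (1 / ((d + \<bar>t\<bar>) * sqrt (d + \<bar>t\<bar>)))"
      unfolding w_def .
  qed
  also have "4 * (\<kappa> * K / sqrt d) / sqrt d = 4 * \<kappa> * K / d" using d by simp
  finally show ?thesis by (simp add: K_def)
qed

end

end

end

section \<open>Poisson kernel and Herglotz transform\<close>

definition poisson_real :: "real \<Rightarrow> real \<Rightarrow> real" where
  "poisson_real \<rho> t = (1 - \<rho>\<^sup>2) / (1 + \<rho>\<^sup>2 - 2 * \<rho> * cos (2 * pi * t))"

lemma norm_circ_diff_sq: "(cmod (circ t - of_real \<rho>))\<^sup>2 = 1 + \<rho>\<^sup>2 - 2 * \<rho> * cos (2 * pi * t)"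
proof -
  have "(cmod (circ t - of_real \<rho>))\<^sup>2 = (cos (2 * pi * t) - \<rho>)\<^sup>2 + (sin (2 * pi * t))\<^sup>2"
    by (simp add: cmod_power2 circ_eq_cis)
  also have "\<dots> = (sin (2 * pi * t))\<^sup>2 + (cos (2 * pi * t))\<^sup>2 + \<rho>\<^sup>2 - 2 * \<rho> * cos (2 * pi * t)"
    by (simp add: power2_eq_square algebra_simps)
  finally show ?thesis by simp
qed

lemma circ_minus: "circ (x - y) = circ x / circ y"
  using circ_add[of "x - y" y] by (simp add: field_simps)

lemma norm_circ_sub: "cmod (circ s - of_real \<rho> * circ x) = cmod (circ (s - x) - of_real \<rho>)"
proof -
  have "circ s - of_real \<rho> * circ x = circ x * (circ (s - x) - of_real \<rho>)"
    by (simp add: circ_minus right_diff_distrib)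
  then show ?thesis by (simp add: norm_mult)
qed

lemma poisson_kernel_circ:
  "poisson_kernel (of_real \<rho> * circ x) (circ s) = poisson_real \<rho> (s - x)"
  unfolding poisson_kernel_def poisson_real_def norm_circ_sub norm_circ_diff_sq
  by (simp add: norm_mult)

lemma norm_circ_diff_pos: "\<bar>\<rho>\<bar> < 1 \<Longrightarrow> 0 < cmod (circ t - of_real \<rho>)"
proof -
  assume "\<bar>\<rho>\<bar> < 1"
  then have "cmod (of_real \<rho>) \<noteq> cmod (circ t)" by simp
  then show ?thesis by (metis right_minus_eq zero_less_norm_iff)
qed

lemma poisson_real_denom_pos: "\<bar>\<rho>\<bar> < 1 \<Longrightarrow> 0 < 1 + \<rho>\<^sup>2 - 2 * \<rho> * cos (2 * pi * t)"
  using norm_circ_diff_pos[of \<rho> t] unfolding norm_circ_diff_sq[symmetric] by simp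

lemma circ_derivative_chain:
  assumes "(F has_field_derivative D) (at (circ t))"
  shows "((\<lambda>t. F (circ t)) has_vector_derivative 2 * pi * \<i> * circ t * D) (at t within S)"
  using field_vector_diff_chain_at[OF circ_vector_derivative assms]
  by (auto simp: o_def intro: has_vector_derivative_at_within)

text \<open>Ln (1 - \<rho> / w) / (2 pi i) is a periodic primitive along the circle: |\<rho> / w| <
  1 keeps 1 - \<rho> / w in the right half-plane, away from the branch cut.\<close>

lemma poisson_complex_integral:
  assumes \<rho>: "0 \<le> \<rho>" "\<rho> < 1"
  shows "((\<lambda>t. of_real \<rho> / (circ t - of_real \<rho>)) has_integral 0) {a..a + 1}"
proof -
  define F where "F = (\<lambda>w. Ln (1 - of_real \<rho> / w) / (2 * pi * \<i>))"
  have d: "((\<lambda>t. F (circ t)) has_vector_derivative of_real \<rho> / (circ t - of_real \<rho>)) (at t within S)" for t S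
  proof -
    have n: "cmod (of_real \<rho> / circ t) < 1" using \<rho> by (simp add: norm_divide)
    have re: "0 < Re (1 - of_real \<rho> / circ t)"
      using complex_Re_le_cmod[of "of_real \<rho> / circ t"] n by simp
    have nonpos: "1 - of_real \<rho> / circ t \<notin> \<real>\<^sub>\<le>\<^sub>0" using re by (auto simp: complex_nonpos_Reals_iff)
    have "((\<lambda>w. 1 - of_real \<rho> / w) has_field_derivative of_real \<rho> / (circ t)\<^sup>2) (at (circ t))"
      by (auto intro!: derivative_eq_intros simp: power2_eq_square)
    from DERIV_chain2[OF has_field_derivative_Ln[OF nonpos] this]
    have "(F has_field_derivative (of_real \<rho> / (circ t)\<^sup>2 / (1 - of_real \<rho> / circ t)) / (2 * pi * \<i>)) (at (circ t))"
      unfolding F_def by (intro DERIV_cdivide) (simp add: divide_inverse mult.commute)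
    from circ_derivative_chain[OF this, of S]
    have "((\<lambda>t. F (circ t)) has_vector_derivative
       2 * pi * \<i> * circ t * ((of_real \<rho> / (circ t)\<^sup>2 / (1 - of_real \<rho> / circ t)) / (2 * pi * \<i>))) (at t within S)" .
    moreover have "2 * pi * \<i> * circ t * ((of_real \<rho> / (circ t)\<^sup>2 / (1 - of_real \<rho> / circ t)) / (2 * pi * \<i>))
        = of_real \<rho> / (circ t - of_real \<rho>)"
    proof -
      have "circ t \<noteq> of_real \<rho>" using norm_circ_diff_pos[of \<rho> t] \<rho> by auto
      then show ?thesis by (simp add: divide_simps power2_eq_square)
    qed
    ultimately show ?thesis by simp
  qed
  have "((\<lambda>t. of_real \<rho> / (circ t - of_real \<rho>)) has_integral F (circ (a + 1)) - F (circ a)) {a..a + 1}"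
    by (rule fundamental_theorem_of_calculus) (use d in auto)
  moreover have "circ (a + 1) = circ a" by (subst circ_eq_iff) simp
  ultimately show ?thesis by simp
qed

lemma poisson_real_integral:
  assumes \<rho>: "0 \<le> \<rho>" "\<rho> < 1"
  shows "(poisson_real \<rho> has_integral 1) {a..a + 1}"
proof -
  have "poisson_real \<rho> t = 1 + 2 * Re (of_real \<rho> / (circ t - of_real \<rho>))" for t
  proof -
    have "Re (of_real \<rho> / (circ t - of_real \<rho>)) = \<rho> * (cos (2 * pi * t) - \<rho>) / (cmod (circ t - of_real \<rho>))\<^sup>2"
      unfolding Re_divide cmod_power2[symmetric] by (simp add: circ_eq_cis)
    then show ?thesis
      unfolding poisson_real_def norm_circ_diff_sq
      using poisson_real_denom_pos[of \<rho> t] \<rho> by (simp add: field_simps power2_eq_square)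
  qed
  then have eq: "poisson_real \<rho> = (\<lambda>t. 1 + 2 * Re (of_real \<rho> / (circ t - of_real \<rho>)))" by auto
  have "((\<lambda>t. Re (of_real \<rho> / (circ t - of_real \<rho>))) has_integral Re 0) {a..a + 1}"
    using has_integral_linear[OF poisson_complex_integral[OF \<rho>, of a] bounded_linear_Re] by (simp add: o_def)
  then have "((\<lambda>t. 1 + 2 * Re (of_real \<rho> / (circ t - of_real \<rho>))) has_integral (1 * (a + 1 - a) + 2 * Re 0)) {a..a + 1}"
    by (intro has_integral_add has_integral_mult_right) (use has_integral_const_real[of "1::real" a "a + 1"] in simp)
  then show ?thesis unfolding eq by simp
qed

text \<open>The square of the distance is d^2 + 4 (1 - d) sin^2 (pi t), where 1 - d \<ge> 1/2 and
  sin (pi |t|) \<ge> 2 |t| / 3.\<close>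

lemma circ_diff_lower:
  assumes d: "0 < d" "d \<le> 1/2" and t: "\<bar>t\<bar> \<le> 1/2"
  shows "(d + \<bar>t\<bar>) / 2 \<le> cmod (circ t - of_real (1 - d))"
proof -
  define x where "x = pi * \<bar>t\<bar>"
  have x: "0 \<le> x" "x \<le> 2"
    using t pi_less_4 mult_mono[of pi 4 "\<bar>t\<bar>" "1/2"] by (auto simp: x_def)
  \<comment> \<open>sin x \<ge> x - x^3 / 6, and x^2 \<le> 4, so that sin x \<ge> x / 3.\<close>
  have "\<bar>sin x - (\<Sum>m<3. sin_coeff m * x ^ m)\<bar> \<le> inverse (fact 3) * \<bar>x\<bar> ^ 3"
    by (rule Maclaurin_sin_bound)
  then have "\<bar>sin x - x\<bar> \<le> x ^ 3 / 6"
    using x by (simp add: sin_coeff_def eval_nat_numeral)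
  then have "x - sin x \<le> x ^ 3 / 6" by linarith
  also have "\<dots> = x * (x * x) / 6" by (simp add: power3_eq_cube)
  also have "\<dots> \<le> x * (2 * 2) / 6" using x by (intro divide_right_mono mult_left_mono mult_mono) auto
  finally have "x / 3 \<le> sin x" by simp
  moreover have "2 * \<bar>t\<bar> \<le> x" unfolding x_def using pi_ge_two by (intro mult_right_mono) auto
  ultimately have s: "2 * \<bar>t\<bar> / 3 \<le> sin x" by simp
  have "4 / 9 * t\<^sup>2 = (2 * \<bar>t\<bar> / 3)\<^sup>2" by (simp add: power2_eq_square)
  also have "\<dots> \<le> (sin x)\<^sup>2" using s by (intro power_mono) auto
  finally have s2: "4 / 9 * t\<^sup>2 \<le> (sin x)\<^sup>2" .
  have "cos (2 * pi * t) = cos (2 * x)" by (cases "t \<ge> 0") (auto simp: x_def mult_ac)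
  also have "\<dots> = 1 - 2 * (sin x)\<^sup>2" by (rule cos_double_sin)
  finally have c: "cos (2 * pi * t) = 1 - 2 * (sin x)\<^sup>2" .
  have "((d + \<bar>t\<bar>) / 2)\<^sup>2 \<le> (d\<^sup>2 + t\<^sup>2) / 2"
    using sum_squares_ge_zero[of "d - \<bar>t\<bar>" 0] by (simp add: power2_eq_square field_simps)
  also have "\<dots> \<le> d\<^sup>2 + 4 * (1 - d) * (4 / 9 * t\<^sup>2)"
  proof -
    have "2 * (4 / 9 * t\<^sup>2) \<le> 4 * (1 - d) * (4 / 9 * t\<^sup>2)" using d by (intro mult_right_mono) auto
    moreover have "0 \<le> d\<^sup>2" "0 \<le> t\<^sup>2" by auto
    ultimately show ?thesis by argo
  qed
  also have "\<dots> \<le> d\<^sup>2 + 4 * (1 - d) * (sin x)\<^sup>2" using s2 d by (intro add_left_mono mult_left_mono) auto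
  also have "\<dots> = (cmod (circ t - of_real (1 - d)))\<^sup>2"
    unfolding norm_circ_diff_sq c by (simp add: power2_eq_square algebra_simps)
  finally show ?thesis by (rule power2_le_imp_le) simp
qed

lemma circle_dist_lower:
  assumes "cmod \<zeta> = 1" "cmod z < 1"
  shows "1 - cmod z \<le> cmod (\<zeta> - z)" "0 < cmod (\<zeta> - z)" "\<zeta> \<noteq> z"
  using norm_triangle_ineq2[of \<zeta> z] assms by auto

section \<open>The Herglotz transform and the reduction of the Bloch condition to it\<close>

context circle_measure
begin

definition herglotz :: "complex \<Rightarrow> complex" where
  "herglotz z = (\<integral>\<zeta>. (\<zeta> + z) / (\<zeta> - z) \<partial>\<nu>)"

definition herglotz_deriv :: "complex \<Rightarrow> complex" where
  "herglotz_deriv z = (\<integral>\<zeta>. 2 * \<zeta> / (\<zeta> - z)\<^sup>2 \<partial>\<nu>)"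

lemma integrable_circle:
  fixes F :: "complex \<Rightarrow> 'b :: {banach, second_countable_topology}"
  assumes "F \<in> borel_measurable borel" "\<And>\<zeta>. cmod \<zeta> = 1 \<Longrightarrow> norm (F \<zeta>) \<le> K"
  shows "integrable \<nu> F" "norm (\<integral>\<zeta>. F \<zeta> \<partial>\<nu>) \<le> K * mass"
proof -
  have ae: "AE \<zeta> in \<nu>. norm (F \<zeta>) \<le> K" using AE_sphere assms(2) by auto
  show int: "integrable \<nu> F" by (rule integrable_const_bound[OF ae]) (use assms(1) in simp)
  have "norm (\<integral>\<zeta>. F \<zeta> \<partial>\<nu>) \<le> (\<integral>\<zeta>. norm (F \<zeta>) \<partial>\<nu>)" by (rule integral_norm_bound)
  also have "\<dots> \<le> (\<integral>\<zeta>. K \<partial>\<nu>)" using int ae by (intro integral_mono_AE) auto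
  finally show "norm (\<integral>\<zeta>. F \<zeta> \<partial>\<nu>) \<le> K * mass" by (simp add: mult.commute)
qed

lemma herglotz_integrable: "cmod z < 1 \<Longrightarrow> integrable \<nu> (\<lambda>\<zeta>. (\<zeta> + z) / (\<zeta> - z))"
proof (rule integrable_circle(1)[where K = "2 / (1 - cmod z)"])
  fix \<zeta> assume z: "cmod z < 1" "cmod \<zeta> = 1"
  then show "norm ((\<zeta> + z) / (\<zeta> - z)) \<le> 2 / (1 - cmod z)"
    unfolding norm_divide using circle_dist_lower[of \<zeta> z] norm_triangle_ineq[of \<zeta> z]
    by (intro frac_le) auto
qed measurable

lemma herglotz_deriv_bound:
  assumes "cmod z < 1"
  shows "integrable \<nu> (\<lambda>\<zeta>. 2 * \<zeta> / (\<zeta> - z)\<^sup>2)" "cmod (herglotz_deriv z) \<le> 2 / (1 - cmod z)\<^sup>2 * mass"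
proof -
  have b: "norm (2 * \<zeta> / (\<zeta> - z)\<^sup>2) \<le> 2 / (1 - cmod z)\<^sup>2" if "cmod \<zeta> = 1" for \<zeta>
    unfolding norm_divide norm_mult norm_power using circle_dist_lower[of \<zeta> z] that assms
    by (intro frac_le power_mono) auto
  show "integrable \<nu> (\<lambda>\<zeta>. 2 * \<zeta> / (\<zeta> - z)\<^sup>2)" "cmod (herglotz_deriv z) \<le> 2 / (1 - cmod z)\<^sup>2 * mass"
    unfolding herglotz_deriv_def by (rule integrable_circle[OF _ b]; measurable)+
qed

text \<open>The Taylor remainder of the kernel is exactly 2 zeta (w - z)^2 / ((zeta - z)^2 (zeta -
  w)). For |w - z| < r the denominators are bounded below on the circle by (2 r)^2 and r, so the
  remainder is uniformly quadratic in w - z.\<close>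

lemma herglotz_has_derivative:
  assumes z: "cmod z < 1"
  shows "(herglotz has_field_derivative herglotz_deriv z) (at z)"
proof -
  define r where "r = (1 - cmod z) / 2"
  have r: "0 < r" using z by (simp add: r_def)
  define K where "K = 2 / ((2 * r)\<^sup>2 * r) * mass"
  have main: "cmod ((herglotz w - herglotz z) / (w - z) - herglotz_deriv z) \<le> K * cmod (w - z)"
    if w: "w \<noteq> z" "cmod (w - z) < r" for w
  proof -
    have w1: "cmod w \<le> 1 - r" using norm_triangle_ineq2[of w z] w unfolding r_def by argo
    then have w2: "cmod w < 1" using r by simp
    define G where "G = (\<lambda>\<zeta>. (\<zeta> + w) / (\<zeta> - w) - (\<zeta> + z) / (\<zeta> - z) - (w - z) * (2 * \<zeta> / (\<zeta> - z)\<^sup>2))"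
    have Gi: "(\<integral>\<zeta>. G \<zeta> \<partial>\<nu>) = herglotz w - herglotz z - (w - z) * herglotz_deriv z"
      unfolding G_def herglotz_def herglotz_deriv_def
      using herglotz_integrable[OF w2] herglotz_integrable[OF z] herglotz_deriv_bound(1)[OF z]
      by (simp only: integral_mult_right_zero Bochner_Integration.integral_diff
          Bochner_Integration.integrable_diff integrable_mult_right)
    have "norm (\<integral>\<zeta>. G \<zeta> \<partial>\<nu>) \<le> 2 * (cmod (w - z))\<^sup>2 / ((2 * r)\<^sup>2 * r) * mass"
    proof (rule integrable_circle(2))
      show "G \<in> borel_measurable borel" unfolding G_def by measurable
      fix \<zeta> :: complex assume \<zeta>: "cmod \<zeta> = 1"
      have nz: "\<zeta> - w \<noteq> 0" "\<zeta> - z \<noteq> 0" using circle_dist_lower(3)[OF \<zeta>] w2 z by auto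
      have "G \<zeta> * ((\<zeta> - z)\<^sup>2 * (\<zeta> - w)) = 2 * \<zeta> * (w - z)\<^sup>2"
      proof -
        \<comment> \<open>Here a = zeta - w and b = zeta - z; in these variables the remainder
          formula is a rational identity with the nonzero denominators a and b.\<close>
        have *: "((2 * \<zeta> - a) / a - (2 * \<zeta> - b) / b - (b - a) * (2 * \<zeta> / b\<^sup>2)) * (b\<^sup>2 * a) = 2 * \<zeta> * (b - a)\<^sup>2"
          if "a \<noteq> 0" "b \<noteq> 0" for a b :: complex
          using that by (simp add: field_simps power2_eq_square)
        have "2 * \<zeta> - (\<zeta> - w) = \<zeta> + w" "2 * \<zeta> - (\<zeta> - z) = \<zeta> + z" "\<zeta> - z - (\<zeta> - w) = w - z"
          by simp_all
        then show ?thesis unfolding G_def using *[OF nz] by (simp only:)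
      qed
      then have "G \<zeta> = 2 * \<zeta> * (w - z)\<^sup>2 / ((\<zeta> - z)\<^sup>2 * (\<zeta> - w))"
        using nz by (simp add: eq_divide_eq)
      also have "norm \<dots> = 2 * (cmod (w - z))\<^sup>2 / ((cmod (\<zeta> - z))\<^sup>2 * cmod (\<zeta> - w))"
        using \<zeta> by (simp add: norm_divide norm_mult norm_power)
      also have "\<dots> \<le> 2 * (cmod (w - z))\<^sup>2 / ((2 * r)\<^sup>2 * r)"
      proof -
        have "2 * r \<le> cmod (\<zeta> - z)"
          using circle_dist_lower(1)[OF \<zeta> z] by (simp add: r_def)
        moreover have "r \<le> cmod (\<zeta> - w)"
          using circle_dist_lower(1)[OF \<zeta> w2] w1 by linarith
        ultimately show ?thesis
          using r nz by (intro divide_left_mono mult_mono power_mono mult_pos_pos) auto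
      qed
      finally show "norm (G \<zeta>) \<le> 2 * (cmod (w - z))\<^sup>2 / ((2 * r)\<^sup>2 * r)" .
    qed
    then have "cmod (herglotz w - herglotz z - (w - z) * herglotz_deriv z) \<le> K * cmod (w - z) * cmod (w - z)"
      unfolding Gi K_def by (simp add: power2_eq_square mult_ac)
    then have "cmod (herglotz w - herglotz z - (w - z) * herglotz_deriv z) / cmod (w - z) \<le> K * cmod (w - z)"
      using w(1) by (simp add: divide_le_eq)
    then show ?thesis using w(1) unfolding norm_divide[symmetric] by (simp add: diff_divide_distrib)
  qed
  have "((\<lambda>w. (herglotz w - herglotz z) / (w - z) - herglotz_deriv z) \<longlongrightarrow> 0) (at z)"
  proof (rule Lim_null_comparison)
    show "\<forall>\<^sub>F w in at z. norm ((herglotz w - herglotz z) / (w - z) - herglotz_deriv z) \<le> K * cmod (w - z)"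
      unfolding eventually_at using r main by (intro exI[of _ r]) (auto simp: dist_norm)
    show "((\<lambda>w. K * cmod (w - z)) \<longlongrightarrow> 0) (at z)"
      by (rule tendsto_eq_intros refl | simp)+
  qed
  then show ?thesis unfolding has_field_derivative_iff by (simp add: Lim_null[symmetric])
qed

lemma poisson_measurable [measurable]: "poisson_kernel z \<in> borel_measurable borel"
  unfolding poisson_kernel_def by measurable

lemma Re_herglotz:
  assumes z: "cmod z < 1"
  shows "Re (herglotz z) = (\<integral>\<zeta>. poisson_kernel z \<zeta> \<partial>\<nu>)"
proof -
  have "Re (herglotz z) = (\<integral>\<zeta>. Re ((\<zeta> + z) / (\<zeta> - z)) \<partial>\<nu>)"
    unfolding herglotz_def using herglotz_integrable[OF z] by (rule integral_Re[symmetric])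
  also have "\<dots> = (\<integral>\<zeta>. poisson_kernel z \<zeta> \<partial>\<nu>)"
  proof (rule integral_cong_AE)
    have "Re ((\<zeta> + z) / (\<zeta> - z)) = poisson_kernel z \<zeta>" if "cmod \<zeta> = 1" for \<zeta>
    proof -
      have "(Re \<zeta>)\<^sup>2 + (Im \<zeta>)\<^sup>2 = 1" using that by (simp flip: cmod_power2)
      then show ?thesis
        unfolding poisson_kernel_def Re_divide cmod_power2
        by (simp add: power2_eq_square algebra_simps)
    qed
    then show "AE \<zeta> in \<nu>. Re ((\<zeta> + z) / (\<zeta> - z)) = poisson_kernel z \<zeta>" using AE_sphere by auto
  qed auto
  finally show ?thesis .
qed

lemma poisson_nonneg: "cmod z < 1 \<Longrightarrow> 0 \<le> poisson_kernel z \<zeta>"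
  unfolding poisson_kernel_def by (intro divide_nonneg_nonneg) (auto simp: abs_square_le_1)

lemma poisson_le:
  assumes "cmod z < 1" "cmod \<zeta> = 1"
  shows "poisson_kernel z \<zeta> \<le> 1 / (1 - cmod z)\<^sup>2"
  unfolding poisson_kernel_def using circle_dist_lower[OF assms(2,1)] assms
  by (intro frac_le power_mono) auto

lemma Re_herglotz_nonneg: "cmod z < 1 \<Longrightarrow> 0 \<le> Re (herglotz z)"
  unfolding Re_herglotz by (intro integral_nonneg_AE AE_I2 poisson_nonneg)

text \<open>|f exp Q| = 1 throughout the disc, so its modulus has an interior maximum and f exp Q is
  a constant k with |k| = 1. Hence 1/f = exp Q / k.\<close>

lemma bloch_iff_herglotz:
  assumes hol: "f holomorphic_on ball 0 1" and nz: "\<forall>z\<in>ball 0 1. f z \<noteq> 0"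
    and ln: "\<And>z. z \<in> ball 0 1 \<Longrightarrow> - ln (cmod (f z)) = (\<integral>\<zeta>. poisson_kernel z \<zeta> \<partial>\<nu>)"
  shows "bloch (\<lambda>z. 1 / f z) \<longleftrightarrow>
    (\<exists>B. \<forall>z\<in>ball 0 1. (1 - cmod z) * (cmod (herglotz_deriv z) * exp (Re (herglotz z))) \<le> B)"
proof -
  define F where "F = (\<lambda>z. f z * exp (herglotz z))"
  have Hhol: "herglotz holomorphic_on ball 0 1"
    using herglotz_has_derivative by (force simp: holomorphic_on_open)
  have norm_f: "cmod (f z) = exp (- Re (herglotz z))" if "z \<in> ball 0 1" for z
  proof -
    have "ln (cmod (f z)) = - Re (herglotz z)" using ln[OF that] Re_herglotz[of z] that by simp
    then have "exp (ln (cmod (f z))) = exp (- Re (herglotz z))" by simp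
    then show ?thesis using nz that by (subst (asm) exp_ln) auto
  qed
  have norm_F: "cmod (F z) = 1" if "z \<in> ball 0 1" for z
    using norm_f[OF that] by (simp add: F_def norm_mult exp_minus)
  have "F constant_on ball 0 1"
  proof (rule maximum_modulus_principle)
    show "F holomorphic_on ball 0 1" unfolding F_def by (intro holomorphic_intros hol Hhol)
    show "(0::complex) \<in> ball 0 1" by simp
    show "cmod (F z) \<le> cmod (F 0)" if "z \<in> ball 0 1" for z using norm_F that by simp
  qed auto
  then obtain k where k: "\<And>z. z \<in> ball 0 1 \<Longrightarrow> F z = k" by (auto simp: constant_on_def)
  have k1: "cmod k = 1" using norm_F[of 0] k[of 0] by simp
  have k0: "k \<noteq> 0" using k1 by auto
  have g: "1 / f z = exp (herglotz z) / k" if "z \<in> ball 0 1" for z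
    using k[OF that] nz that k0 by (simp add: F_def field_simps)
  have d: "deriv (\<lambda>z. 1 / f z) z = herglotz_deriv z * exp (herglotz z) / k" if z: "z \<in> ball 0 1" for z
  proof (rule DERIV_imp_deriv)
    have "((\<lambda>z. exp (herglotz z) / k) has_field_derivative herglotz_deriv z * exp (herglotz z) / k) (at z)"
      using herglotz_has_derivative[of z] z by (auto intro!: derivative_eq_intros simp: mult_ac k0)
    then show "((\<lambda>z. 1 / f z) has_field_derivative herglotz_deriv z * exp (herglotz z) / k) (at z)"
      by (rule has_field_derivative_transform_within_open[OF _ open_ball z]) (simp add: g)
  qed
  have "(\<lambda>z. 1 / f z) holomorphic_on ball 0 1"
    using nz by (intro holomorphic_intros hol) auto
  moreover have "cmod (deriv (\<lambda>z. 1 / f z) z) = cmod (herglotz_deriv z) * exp (Re (herglotz z))"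
    if "z \<in> ball 0 1" for z
    by (simp add: d[OF that] norm_mult norm_divide k1)
  ultimately show ?thesis unfolding bloch_def by (simp cong: ball_cong_simp)
qed

section \<open>From the arc condition to the Bloch bound\<close>

context
  fixes C :: real
  assumes C: "0 \<le> C" and cond: "contiguous_arc_cond C"
begin

context
  fixes \<theta> d :: real and z :: complex
  assumes d: "0 < d" "d \<le> 1/2" and z: "z = of_real (1 - d) * circ \<theta>"
begin

lemma circ_z_lower: "\<bar>t\<bar> \<le> 1/2 \<Longrightarrow> (d + \<bar>t\<bar>) / 2 \<le> cmod (circ (\<theta> + t) - z)"
  unfolding z norm_circ_sub using circ_diff_lower[OF d, of t] by simp

lemma circ_ne_z: "circ s \<noteq> z"
proof -
  have "cmod z < 1" using d by (simp add: z norm_mult del: of_real_diff)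
  then have "cmod z \<noteq> cmod (circ s)" by simp
  then show ?thesis by metis
qed

lemma circ_shift_derivative:
  assumes "(F has_field_derivative D) (at (circ (\<theta> + t)))"
  shows "((\<lambda>t. F (circ (\<theta> + t))) has_vector_derivative 2 * pi * \<i> * circ (\<theta> + t) * D) (at t within S)"
proof -
  have "((\<lambda>t. \<theta> + t) has_real_derivative 1) (at t)" by (auto intro!: derivative_eq_intros)
  from vector_diff_chain_at[OF this[unfolded has_real_derivative_iff_has_vector_derivative]
      circ_derivative_chain[OF assms, of UNIV]]
  show ?thesis by (auto simp: o_def intro: has_vector_derivative_at_within)
qed

text \<open>The kernel 2 zeta / (zeta - z)^2 has mean 0 on the circle, so A contributes no main
  term. Its derivative gives \<kappa> = 64 pi = 2 pi * 4 * 2^3, the cube being that of the lower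
  bound (d + |t|) / 2.\<close>

lemma herglotz_deriv_estimate:
  defines "A \<equiv> measure \<nu> (arc \<theta> d) / d"
  shows "cmod (herglotz_deriv z) \<le> 6 * (64 * pi) * zyg_const2 C * exp (- A) / d"
proof -
  define \<Phi> where "\<Phi> = (\<lambda>\<zeta>. 2 * \<zeta> / (\<zeta> - z)\<^sup>2)"
  define \<phi>' where "\<phi>' = (\<lambda>t. 2 * pi * \<i> * circ (\<theta> + t) * (- (2 * (circ (\<theta> + t) + z)) / (circ (\<theta> + t) - z) ^ 3))"
  have dd: "(\<Phi> has_field_derivative (- (2 * (w + z)) / (w - z) ^ 3)) (at w)" if "w \<noteq> z" for w
  proof -
    define u where "u = w - z"
    have u: "u \<noteq> 0" "w + z = u + 2 * z" "w = u + z" using that by (auto simp: u_def)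
    have "((\<lambda>\<zeta>. 2 * \<zeta> / (\<zeta> - z)\<^sup>2) has_field_derivative (2 * u\<^sup>2 - 2 * w * (2 * u)) / (u\<^sup>2 * u\<^sup>2)) (at w)"
      using that unfolding u_def by (auto intro!: derivative_eq_intros)
    also have "(2 * u\<^sup>2 - 2 * w * (2 * u)) / (u\<^sup>2 * u\<^sup>2) = - (2 * (w + z)) / u ^ 3"
      using u(1) unfolding u(2) unfolding u(3)
      by (simp add: divide_simps) (simp add: eval_nat_numeral algebra_simps)
    finally show ?thesis unfolding u_def \<Phi>_def .
  qed
  have "cmod ((\<integral>\<zeta>. \<Phi> \<zeta> \<partial>\<nu>) - of_real A * 0) \<le> 6 * (64 * pi) * zyg_const2 C * exp (- A) / d"
    unfolding A_def
  proof (rule kernel_estimate[OF C cond d])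
    show "((\<lambda>t. \<Phi> (circ (\<theta> + t))) has_vector_derivative \<phi>' t) (at t)" for t
      unfolding \<phi>'_def by (rule circ_shift_derivative[OF dd[OF circ_ne_z]])
    show "continuous_on UNIV \<phi>'" unfolding \<phi>'_def by (intro continuous_intros) (auto simp: circ_ne_z)
    show "\<Phi> \<in> borel_measurable borel" unfolding \<Phi>_def by measurable
    show "cmod (\<phi>' t) \<le> 64 * pi / (d + \<bar>t\<bar>) ^ 3" if "\<bar>t\<bar> \<le> 1/2" for t
    proof -
      have "cmod (circ (\<theta> + t) + z) \<le> 2"
        using norm_triangle_ineq[of "circ (\<theta> + t)" z] d by (simp add: z norm_mult del: of_real_diff)
      moreover have "((d + \<bar>t\<bar>) / 2) ^ 3 \<le> cmod (circ (\<theta> + t) - z) ^ 3"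
        using circ_z_lower[OF that] d by (intro power_mono) auto
      moreover have "0 < (d + \<bar>t\<bar>) / 2" using d by simp
      ultimately have le: "2 * cmod (circ (\<theta> + t) + z) / cmod (circ (\<theta> + t) - z) ^ 3
          \<le> 2 * 2 / ((d + \<bar>t\<bar>) / 2) ^ 3"
        by (intro frac_le mult_left_mono zero_less_power) auto
      have "cmod (\<phi>' t) = 2 * pi * (2 * cmod (circ (\<theta> + t) + z) / cmod (circ (\<theta> + t) - z) ^ 3)"
        by (simp add: \<phi>'_def norm_mult norm_divide norm_power minus_divide_left[symmetric] del: distrib_left_numeral)
      also have "\<dots> \<le> 2 * pi * (2 * 2 / ((d + \<bar>t\<bar>) / 2) ^ 3)"
        using le by (intro mult_left_mono) auto
      also have "\<dots> = 64 * pi / (d + \<bar>t\<bar>) ^ 3" by (simp add: power_divide)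
      finally show ?thesis .
    qed
    show "cmod (\<Phi> (circ (\<theta> + 1/2))) \<le> 64 * pi"
    proof -
      have "1 / 4 \<le> cmod (circ (\<theta> + 1/2) - z)" using circ_z_lower[of "1/2"] d by simp
      then have "(1/4)\<^sup>2 \<le> (cmod (circ (\<theta> + 1/2) - z))\<^sup>2" by (intro power_mono) auto
      then have "cmod (\<Phi> (circ (\<theta> + 1/2))) \<le> 2 / (1/4)\<^sup>2"
        unfolding \<Phi>_def norm_mult norm_divide norm_power by (intro frac_le) auto
      also have "\<dots> \<le> 64 * pi" using pi_ge_two by (simp add: power2_eq_square)
      finally show ?thesis .
    qed
    show "((\<lambda>t. \<Phi> (circ (\<theta> + t))) has_integral 0) {-1/2..1/2}"
    proof -
      \<comment> \<open>A single-valued primitive along the circle, as z lies off it; its increment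
        over a full turn is 0.\<close>
      define F where "F = (\<lambda>w. \<i> / (pi * (w - z)))"
      have dF: "(F has_field_derivative - \<i> / (pi * (w - z)\<^sup>2)) (at w)" if "w \<noteq> z" for w
        unfolding F_def using that by (auto intro!: derivative_eq_intros simp: power2_eq_square divide_simps)
      have "((\<lambda>t. F (circ (\<theta> + t))) has_vector_derivative \<Phi> (circ (\<theta> + t))) (at t within S)" for t S
      proof -
        have "2 * pi * \<i> * c * (- \<i> / (pi * D)) = 2 * c / D" for c D :: complex
          by (cases "D = 0") (auto simp: field_simps)
        then show ?thesis
          using circ_shift_derivative[OF dF[OF circ_ne_z], of t S] by (simp only: \<Phi>_def)
      qed
      then have "((\<lambda>t. \<Phi> (circ (\<theta> + t))) has_integral F (circ (\<theta> + 1/2)) - F (circ (\<theta> + -1/2))) {-1/2..1/2}"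
        by (intro fundamental_theorem_of_calculus) auto
      moreover have "circ (\<theta> + 1/2) = circ (\<theta> + -1/2)" by (subst circ_eq_iff) simp
      ultimately show ?thesis by simp
    qed
  qed simp
  then show ?thesis by (simp add: herglotz_deriv_def \<Phi>_def)
qed

text \<open>The Poisson kernel has mean 1, which yields the main term A. Its numerator 1 - \<rho>^2
  \<le> 2 d puts a factor d into \<kappa>, and this cancels the 1/d of
  \<open>kernel_estimate\<close>: only a bounded error remains.\<close>

lemma Re_herglotz_estimate:
  defines "A \<equiv> measure \<nu> (arc \<theta> d) / d"
  shows "\<bar>Re (herglotz z) - A\<bar> \<le> 6 * (256 * pi\<^sup>2) * zyg_const2 C"
proof -
  define \<rho> where "\<rho> = 1 - d"
  define q where "q = (\<lambda>t. 1 + \<rho>\<^sup>2 - 2 * \<rho> * cos (2 * pi * t))"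
  have \<rho>: "0 \<le> \<rho>" "\<rho> < 1" "\<bar>\<rho>\<bar> < 1" "1 - \<rho>\<^sup>2 \<le> 2 * d" "0 \<le> 1 - \<rho>\<^sup>2"
    using d by (auto simp: \<rho>_def power2_eq_square algebra_simps)
  have q: "0 < q t" for t unfolding q_def by (rule poisson_real_denom_pos[OF \<rho>(3)])
  have P: "poisson_kernel z (circ (\<theta> + t)) = poisson_real \<rho> t" for t
    using poisson_kernel_circ[of \<rho> \<theta> "\<theta> + t"] by (simp add: z \<rho>_def)
  have qsq: "q t = (cmod (circ t - of_real \<rho>))\<^sup>2" for t unfolding q_def norm_circ_diff_sq ..
  define p' where "p' = (\<lambda>t. - ((1 - \<rho>\<^sup>2) * (2 * \<rho> * (2 * pi * sin (2 * pi * t))) / (q t)\<^sup>2))"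
  have dp: "(poisson_real \<rho> has_real_derivative p' t) (at t)" for t
  proof -
    have "(q has_real_derivative 2 * \<rho> * (2 * pi * sin (2 * pi * t))) (at t)"
      unfolding q_def by (auto intro!: derivative_eq_intros)
    from DERIV_divide[OF DERIV_const this, of "1 - \<rho>\<^sup>2"]
    have "((\<lambda>t. (1 - \<rho>\<^sup>2) / q t) has_real_derivative p' t) (at t)"
      using q[of t] unfolding p'_def
      by (simp add: power2_eq_square[of "q t"])
    then show ?thesis by (simp add: poisson_real_def[abs_def] q_def)
  qed
  have b: "\<bar>p' t\<bar> \<le> (256 * pi\<^sup>2 * d) / (d + \<bar>t\<bar>) ^ 3" if t: "\<bar>t\<bar> \<le> 1/2" for t
  proof -
    define w where "w = d + \<bar>t\<bar>"
    have w: "0 < w" "\<bar>t\<bar> \<le> w" using d by (auto simp: w_def)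
    have "(w / 2)\<^sup>2 \<le> q t" unfolding qsq w_def \<rho>_def using circ_diff_lower[OF d t] d by (intro power_mono) auto
    then have "((w / 2)\<^sup>2)\<^sup>2 \<le> (q t)\<^sup>2" by (intro power_mono) auto
    moreover have "\<bar>sin (2 * pi * t)\<bar> \<le> 2 * pi * \<bar>t\<bar>" using abs_sin_le_one abs_sin_x_le_abs_x[of "2 * pi * t"] by (simp add: abs_mult)
    then have "(1 - \<rho>\<^sup>2) * (2 * \<rho> * (2 * pi * \<bar>sin (2 * pi * t)\<bar>)) \<le> 2 * d * (2 * 1 * (2 * pi * (2 * pi * w)))"
      using \<rho> d w by (intro mult_mono) (auto intro: order.trans)
    ultimately have "\<bar>p' t\<bar> \<le> 2 * d * (2 * 1 * (2 * pi * (2 * pi * w))) / ((w / 2)\<^sup>2)\<^sup>2"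
      unfolding p'_def abs_divide abs_mult abs_minus_cancel using \<rho> w
      by (intro frac_le) auto
    also have "\<dots> = (256 * pi\<^sup>2 * d) / w ^ 3" using w by (simp add: field_simps eval_nat_numeral)
    finally show ?thesis unfolding w_def .
  qed
  have "cmod ((\<integral>\<zeta>. of_real (poisson_kernel z \<zeta>) \<partial>\<nu>) - of_real A * 1)
      \<le> 6 * (256 * pi\<^sup>2 * d) * zyg_const2 C * exp (- A) / d"
    unfolding A_def
  proof (rule kernel_estimate[OF C cond d])
    show "((\<lambda>t. of_real (poisson_real \<rho> t) :: complex) has_vector_derivative of_real (p' t)) (at t)" for t
      using dp[of t] by (intro has_vector_derivative_of_real)
    show "continuous_on UNIV (\<lambda>t. of_real (p' t) :: complex)"
      unfolding p'_def by (intro continuous_intros) (use q in \<open>auto simp: q_def intro!: continuous_intros simp: less_le\<close>)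
    show "complex_of_real (poisson_kernel z (circ (\<theta> + t))) = of_real (poisson_real \<rho> t)" for t by (simp add: P)
    show "(\<lambda>\<zeta>. complex_of_real (poisson_kernel z \<zeta>)) \<in> borel_measurable borel" by measurable
    show "cmod (of_real (p' t)) \<le> 256 * pi\<^sup>2 * d / (d + \<bar>t\<bar>) ^ 3" if "\<bar>t\<bar> \<le> 1/2" for t
      using b[OF that] by simp
    show "cmod (of_real (poisson_real \<rho> (1/2))) \<le> 256 * pi\<^sup>2 * d"
    proof -
      have "poisson_real \<rho> (1/2) = (1 - \<rho>\<^sup>2) / (1 + \<rho>)\<^sup>2" by (simp add: poisson_real_def power2_eq_square algebra_simps)
      also have "\<bar>\<dots>\<bar> \<le> 2 * d / 1" using \<rho> by (simp only: abs_divide) (intro frac_le; simp)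
      also have "\<dots> \<le> 256 * pi\<^sup>2 * d"
      proof -
        have "1 \<le> pi\<^sup>2" using pi_ge_two by (intro one_le_power) auto
        then show ?thesis using d by simp
      qed
      finally show ?thesis by simp
    qed
    show "((\<lambda>t. complex_of_real (poisson_real \<rho> t)) has_integral 1) {-1/2..1/2}"
      using has_integral_linear[OF poisson_real_integral[OF \<rho>(1,2), of "-1/2"] bounded_linear_of_real]
      by (simp add: o_def)
  qed
  also have "(\<integral>\<zeta>. complex_of_real (poisson_kernel z \<zeta>) \<partial>\<nu>) = of_real (Re (herglotz z))"
    using d by (subst Re_herglotz) (auto simp: z norm_mult simp del: of_real_diff)
  also have "cmod (of_real (Re (herglotz z)) - of_real A * 1) = \<bar>Re (herglotz z) - A\<bar>"
    by (simp flip: of_real_diff)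
  also have "6 * (256 * pi\<^sup>2 * d) * zyg_const2 C * exp (- A) / d = 6 * (256 * pi\<^sup>2) * zyg_const2 C * exp (- A)"
    using d by simp
  also have "\<dots> \<le> 6 * (256 * pi\<^sup>2) * zyg_const2 C * 1"
  proof (rule mult_left_mono)
    have "0 \<le> A" using d by (simp add: A_def)
    then show "exp (- A) \<le> 1" by simp
    show "0 \<le> 6 * (256 * pi\<^sup>2) * zyg_const2 C"
      using zyg_const2_ge[OF C] zyg_const_ge[OF C] C by simp
  qed
  finally show ?thesis by simp
qed

end

text \<open>For |z| \<ge> 1/2 the decay exp (- A) / d of Q' meets exp (Re Q) \<le> exp (A + K2), and
  A cancels. For |z| < 1/2 the length 1 - |z| exceeds 1/2, the longest arc allowed, but there the
  kernels are bounded.\<close>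

lemma bloch_bound_of_contiguous_arcs:
  "\<exists>B. \<forall>z\<in>ball 0 1. (1 - cmod z) * (cmod (herglotz_deriv z) * exp (Re (herglotz z))) \<le> B"
proof -
  define K1 where "K1 = 6 * (64 * pi) * zyg_const2 C"
  define K2 where "K2 = 6 * (256 * pi\<^sup>2) * zyg_const2 C"
  define K3 where "K3 = 8 * mass * exp (4 * mass)"
  have K1: "0 \<le> K1" using zyg_const2_ge[OF C] zyg_const_ge[OF C] C by (simp add: K1_def)
  have "(1 - cmod z) * (cmod (herglotz_deriv z) * exp (Re (herglotz z))) \<le> max (K1 * exp K2) K3"
    if z: "z \<in> ball 0 1" for z
  proof (cases "cmod z < 1/2")
    case True
    have h: "(1/2)\<^sup>2 \<le> (1 - cmod z)\<^sup>2" using True by (intro power_mono) auto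
    have "cmod (herglotz_deriv z) \<le> 2 / (1 - cmod z)\<^sup>2 * mass" using herglotz_deriv_bound(2) z by simp
    also have "\<dots> \<le> 2 / (1/2)\<^sup>2 * mass" using h True by (intro mult_right_mono frac_le) auto
    finally have 1: "cmod (herglotz_deriv z) \<le> 8 * mass" by (simp add: power2_eq_square)
    have "norm (\<integral>\<zeta>. poisson_kernel z \<zeta> \<partial>\<nu>) \<le> 1 / (1/2)\<^sup>2 * mass"
    proof (rule integrable_circle(2))
      fix \<zeta> :: complex assume \<zeta>: "cmod \<zeta> = 1"
      have "poisson_kernel z \<zeta> \<le> 1 / (1 - cmod z)\<^sup>2" using poisson_le z \<zeta> by simp
      also have "\<dots> \<le> 1 / (1/2)\<^sup>2" using h True by (intro frac_le) auto
      finally show "norm (poisson_kernel z \<zeta>) \<le> 1 / (1/2)\<^sup>2" using poisson_nonneg[of z \<zeta>] z by simp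
    qed simp
    then have 2: "Re (herglotz z) \<le> 4 * mass" using Re_herglotz[of z] z by (simp add: power2_eq_square)
    have "(1 - cmod z) * (cmod (herglotz_deriv z) * exp (Re (herglotz z))) \<le> 1 * (8 * mass * exp (4 * mass))"
      using 1 2 z by (intro mult_mono) auto
    then show ?thesis by (simp add: K3_def)
  next
    case False
    define d where "d = 1 - cmod z"
    have d: "0 < d" "d \<le> 1/2" using z False by (auto simp: d_def)
    have z0: "of_real (cmod z) \<noteq> (0 :: complex)" using False by auto
    have "cmod (z / of_real (cmod z)) = 1" using z0 by (simp add: norm_divide)
    then obtain \<theta> where "z / of_real (cmod z) = circ \<theta>" using sphere_circ_ex by metis
    then have z': "z = of_real (1 - d) * circ \<theta>"
      using z0 by (simp add: d_def divide_eq_eq mult.commute)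
    define A where "A = measure \<nu> (arc \<theta> d) / d"
    have "exp (Re (herglotz z)) \<le> exp (A + K2)"
      using Re_herglotz_estimate[OF d z'] by (simp add: A_def K2_def)
    then have "d * (cmod (herglotz_deriv z) * exp (Re (herglotz z))) \<le> d * (K1 * exp (- A) / d * exp (A + K2))"
      using herglotz_deriv_estimate[OF d z'] d K1 unfolding K1_def A_def by (intro mult_mono) auto
    also have "\<dots> = K1 * exp K2" using d by (simp add: exp_add exp_minus)
    finally show ?thesis by (simp add: d_def)
  qed
  then show ?thesis by blast
qed

end

end

section \<open>Boundary values\<close>

context circle_measure
begin

text \<open>Here the interior point moves and the boundary point is fixed; the kernel depends only
  on the difference of angles and is even in it.\<close>

lemma poisson_shift_integral:
  assumes "0 \<le> \<rho>" "\<rho> < 1"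
  shows "((\<lambda>x. poisson_kernel (of_real \<rho> * circ x) (circ s)) has_integral 1) {a..a + 1}"
proof -
  have "((poisson_real \<rho> \<circ> (+) (- s)) has_integral 1) {a..a + 1}"
    unfolding has_integral_shift_Icc_real
    using poisson_real_integral[OF assms, of "a - s"] by (simp add: algebra_simps)
  then have "((\<lambda>x. poisson_real \<rho> (x + - s)) has_integral 1) {a..a + 1}"
    by (simp add: o_def add.commute)
  moreover have "poisson_real \<rho> (x + - s) = poisson_kernel (of_real \<rho> * circ x) (circ s)" for x
  proof -
    have "2 * pi * (x + - s) = - (2 * pi * (s - x))" by (simp add: algebra_simps)
    then show ?thesis unfolding poisson_kernel_circ poisson_real_def by (simp only: cos_minus)
  qed
  ultimately show ?thesis by simp
qed

lemma poisson_circ_continuous: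
  assumes "\<bar>\<rho>\<bar> < 1" "cmod \<zeta> = 1"
  shows "continuous_on S (\<lambda>x. poisson_kernel (of_real \<rho> * circ x) \<zeta>)"
proof -
  have "\<zeta> \<noteq> of_real \<rho> * circ x" for x
    by (rule circle_dist_lower(3)) (use assms in \<open>auto simp: norm_mult\<close>)
  then show ?thesis unfolding poisson_kernel_def by (intro continuous_intros) auto
qed

lemma poisson_off_arc_tendsto:
  assumes \<rho>: "\<rho> \<longlonglongrightarrow> 1" "\<And>n. 0 \<le> \<rho> n" "\<And>n. \<rho> n < 1" and bc: "b \<le> c"
    and \<zeta>: "cmod \<zeta> = 1" "\<zeta> \<notin> circ ` {b..c}"
  shows "(\<lambda>n. integral {b..c} (\<lambda>x. poisson_kernel (of_real (\<rho> n) * circ x) \<zeta>)) \<longlonglongrightarrow> 0"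
proof -
  obtain d where d: "0 < d" "\<And>x. x \<in> {b..c} \<Longrightarrow> d \<le> dist \<zeta> (circ x)"
    using separate_point_closed[OF closed_circ_image \<zeta>(2)] by blast
  have "\<forall>\<^sub>F n in sequentially. 1 - d / 2 < \<rho> n"
    using \<rho>(1) d(1) by (intro order_tendstoD) auto
  then have bound: "\<forall>\<^sub>F n in sequentially.
      norm (integral {b..c} (\<lambda>x. poisson_kernel (of_real (\<rho> n) * circ x) \<zeta>))
       \<le> (1 - (\<rho> n)\<^sup>2) / (d / 2)\<^sup>2 * (c - b)"
  proof eventually_elim
    case (elim n)
    have "norm (poisson_kernel (of_real (\<rho> n) * circ x) \<zeta>) \<le> (1 - (\<rho> n)\<^sup>2) / (d / 2)\<^sup>2"
      if "x \<in> {b..c}" for x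
    proof -
      have "cmod (circ x - of_real (\<rho> n) * circ x) = 1 - \<rho> n"
      proof -
        have "circ x - of_real (\<rho> n) * circ x = of_real (1 - \<rho> n) * circ x"
          by (simp add: left_diff_distrib)
        then show ?thesis using \<rho>(3)[of n] by (simp add: norm_mult del: of_real_diff)
      qed
      then have "d / 2 \<le> cmod (\<zeta> - of_real (\<rho> n) * circ x)"
        using d(2)[OF that] elim norm_triangle_ineq[of "\<zeta> - of_real (\<rho> n) * circ x" "- (circ x - of_real (\<rho> n) * circ x)"]
        by (simp add: dist_norm norm_minus_commute)
      then have "(d / 2)\<^sup>2 \<le> (cmod (\<zeta> - of_real (\<rho> n) * circ x))\<^sup>2"
        using d(1) by (intro power_mono) auto
      moreover have "0 \<le> 1 - (\<rho> n)\<^sup>2" using \<rho>(2)[of n] \<rho>(3)[of n] by (simp add: abs_square_le_1)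
      ultimately show ?thesis
        unfolding poisson_kernel_def using \<rho>(2)[of n] d(1)
        by (simp add: norm_mult) (intro divide_left_mono; auto intro!: mult_pos_pos)
    qed
    then have "norm (integral {b..c} (\<lambda>x. poisson_kernel (of_real (\<rho> n) * circ x) \<zeta>))
        \<le> integral {b..c} (\<lambda>x. (1 - (\<rho> n)\<^sup>2) / (d / 2)\<^sup>2)"
      using \<rho>(2)[of n] \<rho>(3)[of n]
      by (intro integral_norm_bound_integral integrable_continuous_interval poisson_circ_continuous \<zeta>) auto
    then show ?case using bc by (simp add: mult.commute)
  qed
  have "(\<lambda>n. (1 - (\<rho> n)\<^sup>2) / (d / 2)\<^sup>2 * (c - b)) \<longlonglongrightarrow> (1 - 1\<^sup>2) / (d / 2)\<^sup>2 * (c - b)"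
    using d(1) by (intro tendsto_intros \<rho>(1)) auto
  then show ?thesis by (intro Lim_null_comparison[OF bound]) simp
qed

text \<open>Off the closed arc the kernels tend to 0 uniformly. Inside it, the integral is 1 minus
  that over the complementary arc, to which the same applies. The endpoints are excluded because
  half of the kernel's mass falls on each side.\<close>

lemma poisson_arc_tendsto:
  assumes \<rho>: "\<rho> \<longlonglongrightarrow> 1" "\<And>n. 0 \<le> \<rho> n" "\<And>n. \<rho> n < 1" and l: "0 < l" "l < 1"
    and \<zeta>: "cmod \<zeta> = 1" "\<zeta> \<noteq> circ a" "\<zeta> \<noteq> circ (a + l)"
  shows "(\<lambda>n. integral {a..a + l} (\<lambda>x. poisson_kernel (of_real (\<rho> n) * circ x) \<zeta>))
      \<longlonglongrightarrow> indicator (arc a l) \<zeta>"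
proof -
  obtain s where s: "a \<le> s" "s < a + 1" "\<zeta> = circ s" by (rule sphere_circ_ex[OF \<zeta>(1)])
  have s': "s \<noteq> a" "s \<noteq> a + l" using \<zeta> s by auto
  have notin: "\<zeta> \<notin> circ ` {b..c}" if "s < b \<or> c < s" "\<And>v. v \<in> {b..c} \<Longrightarrow> \<bar>s - v\<bar> < 1" for b c
    using circ_inj[of s] that s(3) by force
  show ?thesis
  proof (cases "s < a + l")
    case True
    have "\<zeta> \<notin> circ ` {a + l..a + 1}" by (rule notin) (use True s s' l in auto)
    then have "(\<lambda>n. 1 - integral {a + l..a + 1} (\<lambda>x. poisson_kernel (of_real (\<rho> n) * circ x) \<zeta>)) \<longlonglongrightarrow> 1 - 0"
      using l by (intro tendsto_intros poisson_off_arc_tendsto[OF \<rho>] \<zeta>) auto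
    moreover have "1 - integral {a + l..a + 1} (\<lambda>x. poisson_kernel (of_real (\<rho> n) * circ x) \<zeta>)
        = integral {a..a + l} (\<lambda>x. poisson_kernel (of_real (\<rho> n) * circ x) \<zeta>)" for n
    proof -
      have i: "((\<lambda>x. poisson_kernel (of_real (\<rho> n) * circ x) \<zeta>) has_integral 1) {a..a + 1}"
        unfolding s(3) by (rule poisson_shift_integral[OF \<rho>(2,3)])
      have "integral {a..a + l} (\<lambda>x. poisson_kernel (of_real (\<rho> n) * circ x) \<zeta>)
          + integral {a + l..a + 1} (\<lambda>x. poisson_kernel (of_real (\<rho> n) * circ x) \<zeta>) = 1"
        using Henstock_Kurzweil_Integration.integral_combine[OF _ _ has_integral_integrable[OF i], of "a + l"]
          integral_unique[OF i] l by simp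
      then show ?thesis by simp
    qed
    moreover have "\<zeta> \<in> arc a l" using s True by (auto simp: arc_def)
    ultimately show ?thesis by simp
  next
    case False
    have n: "\<zeta> \<notin> circ ` {a..a + l}" by (rule notin) (use False s s' l in auto)
    then have "\<zeta> \<notin> arc a l" by (auto simp: arc_def)
    then show ?thesis using poisson_off_arc_tendsto[OF \<rho> _ \<zeta>(1) n] l by simp
  qed
qed

text \<open>After Fubini the integrands J n lie between 0 and 1 on the circle and tend to the
  indicator of the arc except at its endpoints, which are null; dominated convergence
  applies.\<close>

lemma herglotz_arc_tendsto:
  assumes \<rho>: "\<rho> \<longlonglongrightarrow> 1" "\<And>n. 0 \<le> \<rho> n" "\<And>n. \<rho> n < 1" and l: "0 < l" "l < 1"
    and atoms: "\<And>s. measure \<nu> {circ s} = 0"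
  shows "(\<lambda>n. integral {a..a + l} (\<lambda>x. Re (herglotz (of_real (\<rho> n) * circ x)))) \<longlonglongrightarrow> measure \<nu> (arc a l)"
proof -
  \<comment> \<open>The cutoff off the circle gives a bound valid for every zeta, as
    \<open>integral_swap_interval\<close> requires.\<close>
  define g where "g = (\<lambda>n x \<zeta>. if cmod \<zeta> = 1 then poisson_kernel (of_real (\<rho> n) * circ x) \<zeta> else 0)"
  have less1: "cmod (of_real (\<rho> n) * circ x) < 1" for n x using \<rho>(2,3) by (simp add: norm_mult)
  have gm: "case_prod (g n) \<in> borel_measurable (borel \<Otimes>\<^sub>M borel)" for n
    unfolding g_def poisson_kernel_def by measurable
  have gb: "norm (g n x \<zeta>) \<le> 1 / (1 - \<rho> n)\<^sup>2" for n x \<zeta>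
    using poisson_le[OF less1[of n x], of \<zeta>] poisson_nonneg[OF less1[of n x], of \<zeta>] \<rho>(2)[of n]
    by (auto simp: g_def norm_mult split: split_indicator)
  have inner: "(\<integral>\<zeta>. g n x \<zeta> \<partial>\<nu>) = Re (herglotz (of_real (\<rho> n) * circ x))" for n x
    unfolding Re_herglotz[OF less1]
  proof (rule integral_cong_AE)
    show "AE \<zeta> in \<nu>. g n x \<zeta> = poisson_kernel (of_real (\<rho> n) * circ x) \<zeta>"
      using AE_sphere by eventually_elim (simp add: g_def)
    show "g n x \<in> borel_measurable \<nu>" unfolding g_def by measurable
  qed simp
  define J where "J = (\<lambda>n \<zeta>. integral {a..a + l} (\<lambda>x. g n x \<zeta>))"
  have Jm: "J n \<in> borel_measurable borel" for n
    unfolding J_def by (rule integral_swap_interval(2)[OF gm gb])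
  have Jeq: "J n \<zeta> = integral {a..a + l} (\<lambda>x. poisson_kernel (of_real (\<rho> n) * circ x) \<zeta>)" if "cmod \<zeta> = 1" for n \<zeta>
    using that by (simp add: J_def g_def)
  have no_atom: "AE \<zeta> in \<nu>. \<zeta> \<noteq> circ s" for s
    using atoms[of s] by (intro AE_I[where N = "{circ s}"]) (auto simp: sets_nu emeasure_eq_measure)
  have "(\<lambda>n. \<integral>\<zeta>. J n \<zeta> \<partial>\<nu>) \<longlonglongrightarrow> (\<integral>\<zeta>. indicator (arc a l) \<zeta> \<partial>\<nu>)"
  proof (rule integral_dominated_convergence[where w = "\<lambda>_. 1"])
    show "AE \<zeta> in \<nu>. (\<lambda>n. J n \<zeta>) \<longlonglongrightarrow> indicator (arc a l) \<zeta>"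
      using AE_sphere no_atom[of a] no_atom[of "a + l"]
      by eventually_elim (simp add: Jeq poisson_arc_tendsto[OF \<rho> l])
    show "AE \<zeta> in \<nu>. norm (J n \<zeta>) \<le> 1" for n
      using AE_sphere
    proof eventually_elim
      case (elim \<zeta>)
      obtain s where s: "\<zeta> = circ s" using sphere_circ_ex[OF elim] by metis
      have int: "(\<lambda>x. poisson_kernel (of_real (\<rho> n) * circ x) \<zeta>) integrable_on S" if "S = {u..v}" for S u v
        unfolding that using \<rho>(2)[of n] \<rho>(3)[of n] by (intro integrable_continuous_interval poisson_circ_continuous elim) auto
      have "J n \<zeta> \<le> integral {a..a + 1} (\<lambda>x. poisson_kernel (of_real (\<rho> n) * circ x) \<zeta>)"
        unfolding Jeq[OF elim] using l by (intro integral_subset_le int) (auto intro: poisson_nonneg less1)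
      also have "\<dots> = 1" unfolding s by (rule integral_unique[OF poisson_shift_integral[OF \<rho>(2,3)]])
      finally have "J n \<zeta> \<le> 1" .
      moreover have "0 \<le> J n \<zeta>"
        unfolding Jeq[OF elim] by (intro integral_nonneg int) (auto intro: poisson_nonneg less1)
      ultimately show ?case by simp
    qed
  qed (use Jm in \<open>auto simp: sets_nu\<close>)
  moreover have "(\<integral>\<zeta>. J n \<zeta> \<partial>\<nu>) = integral {a..a + l} (\<lambda>x. Re (herglotz (of_real (\<rho> n) * circ x)))" for n
    unfolding J_def integral_swap_interval(1)[OF gm gb] inner ..
  ultimately show ?thesis by (simp add: sets_nu)
qed

definition hp_exp :: "complex \<Rightarrow> complex" where
  "hp_exp w = exp (2 * pi * \<i> * w)"

lemma hp_exp_eq: "hp_exp w = of_real (exp (- 2 * pi * Im w)) * circ (Re w)"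
proof -
  have "2 * pi * \<i> * w = of_real (- 2 * pi * Im w) + 2 * pi * \<i> * of_real (Re w)"
    by (simp add: complex_eq_iff)
  then show ?thesis by (simp only: hp_exp_def circ_def exp_add exp_of_real) simp
qed

lemma norm_hp_exp: "cmod (hp_exp w) = exp (- 2 * pi * Im w)"
  by (simp add: hp_exp_eq norm_mult)

lemma norm_hp_exp_less: "0 < Im w \<Longrightarrow> cmod (hp_exp w) < 1"
  by (simp add: norm_hp_exp)

section \<open>From the Bloch bound to the arc condition\<close>

context
  fixes B :: real
  assumes B: "\<And>z. z \<in> ball 0 1 \<Longrightarrow> (1 - cmod z) * (cmod (herglotz_deriv z) * exp (Re (herglotz z))) \<le> B"
begin

definition hp_herglotz :: "complex \<Rightarrow> complex" where
  "hp_herglotz w = herglotz (hp_exp w)"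

text \<open>With y = 2 pi Im w, Im w times |dz/dw| is y exp (- y), and this is at most 1 - exp (- y)
  = 1 - |z|. The disc bound therefore carries over with the same B.\<close>

lemma half_plane_bloch_herglotz:
  "half_plane_bloch hp_herglotz (\<lambda>w. herglotz_deriv (hp_exp w) * (2 * pi * \<i> * hp_exp w)) B"
proof
  fix w assume w: "0 < Im w"
  note e = norm_hp_exp_less[OF w]
  have "(hp_exp has_field_derivative 2 * pi * \<i> * hp_exp w) (at w)"
    unfolding hp_exp_def by (auto intro!: derivative_eq_intros)
  from DERIV_chain2[OF herglotz_has_derivative[OF e] this]
  show "(hp_herglotz has_field_derivative herglotz_deriv (hp_exp w) * (2 * pi * \<i> * hp_exp w)) (at w)"
    by (simp add: hp_herglotz_def[abs_def])
  show "0 \<le> Re (hp_herglotz w)" unfolding hp_herglotz_def by (rule Re_herglotz_nonneg[OF e])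
  define y where "y = 2 * pi * Im w"
  have "y * exp (- y) \<le> 1 - exp (- y)"
    using exp_ge_add_one_self[of y] by (simp add: exp_minus field_simps)
  then have "Im w * (2 * pi * cmod (hp_exp w)) \<le> 1 - cmod (hp_exp w)"
    by (simp add: norm_hp_exp y_def mult_ac)
  then have "Im w * (2 * pi * cmod (hp_exp w)) * (cmod (herglotz_deriv (hp_exp w)) * exp (Re (hp_herglotz w)))
      \<le> (1 - cmod (hp_exp w)) * (cmod (herglotz_deriv (hp_exp w)) * exp (Re (hp_herglotz w)))"
    by (intro mult_right_mono) auto
  also have "\<dots> \<le> B" unfolding hp_herglotz_def using e by (intro B) simp
  finally show "Im w * (cmod (herglotz_deriv (hp_exp w) * (2 * pi * \<i> * hp_exp w)) * exp (Re (hp_herglotz w))) \<le> B"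
    by (simp add: norm_mult mult_ac)
qed

interpretation hp: half_plane_bloch hp_herglotz "\<lambda>w. herglotz_deriv (hp_exp w) * (2 * pi * \<i> * hp_exp w)" B
  by (rule half_plane_bloch_herglotz)

text \<open>At height y over the point the Poisson kernel is at least 1 / (2 pi y) there, so an atom
  would force Re Q to grow like 1/y. But Re Q \<le> exp (Re Q), which grows at most like log
  (1/y).\<close>

lemma no_atoms: "measure \<nu> {circ \<theta>} = 0"
proof -
  define z0 where "z0 = Complex \<theta> 1"
  define K where "K = cmod (exp (hp_herglotz z0))"
  have main: "measure \<nu> {circ \<theta>} \<le> 2 * pi * y * (K + 2 * B * ln (1 / y))" if y: "0 < y" "y \<le> 1" for y
  proof -
    \<comment> \<open>The vertical segment from \<theta> + i down to the boundary point \<theta> has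
      height y at parameter 1 - y.\<close>
    define w where "w = hp.seg z0 (of_real \<theta>) (1 - y)"
    have w: "w = Complex \<theta> y"
      unfolding w_def z0_def by (subst hp.seg_def[where l = 1]) (auto simp: complex_eq_iff cmod_def)
    have "cmod (exp (hp_herglotz w) - exp (hp_herglotz z0)) \<le> 2 * B * ln (1 / (1 - (1 - y)))"
      unfolding w_def by (rule hp.exp_h_seg[where l = 1]) (use y in \<open>auto simp: z0_def cmod_def\<close>)
    then have "exp (Re (hp_herglotz w)) \<le> K + 2 * B * ln (1 / y)"
      using norm_triangle_ineq2[of "exp (hp_herglotz w)" "exp (hp_herglotz z0)"] by (simp add: K_def)
    then have up: "Re (hp_herglotz w) \<le> K + 2 * B * ln (1 / y)"
      using exp_ge_add_one_self[of "Re (hp_herglotz w)"] by linarith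
    define \<rho> where "\<rho> = exp (- 2 * pi * y)"
    have \<rho>: "0 < \<rho>" "\<rho> < 1" using y by (auto simp: \<rho>_def)
    have z: "hp_exp w = of_real \<rho> * circ \<theta>" unfolding hp_exp_eq w \<rho>_def by simp
    have less1: "cmod (of_real \<rho> * circ \<theta>) < 1" using \<rho> by (simp add: norm_mult)
    have "1 - \<rho> \<le> 2 * pi * y" using exp_ge_add_one_self[of "- 2 * pi * y"] by (simp add: \<rho>_def)
    then have "1 / (2 * pi * y) \<le> 1 / (1 - \<rho>)" using \<rho> by (intro divide_left_mono) auto
    also have "\<dots> \<le> (1 + \<rho>) / (1 - \<rho>)" using \<rho> by (intro divide_right_mono) auto
    also have "\<dots> = poisson_kernel (of_real \<rho> * circ \<theta>) (circ \<theta>)"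
    proof -
      have "poisson_kernel (of_real \<rho> * circ \<theta>) (circ \<theta>) = (1 - \<rho>\<^sup>2) / (1 - \<rho>)\<^sup>2"
        unfolding poisson_kernel_circ poisson_real_def by (simp add: power2_eq_square algebra_simps)
      also have "\<dots> = (1 + \<rho>) * (1 - \<rho>) / ((1 - \<rho>) * (1 - \<rho>))"
        by (simp add: power2_eq_square algebra_simps)
      also have "\<dots> = (1 + \<rho>) / (1 - \<rho>)" using \<rho> by simp
      finally show ?thesis by simp
    qed
    finally have P: "1 / (2 * pi * y) \<le> poisson_kernel (of_real \<rho> * circ \<theta>) (circ \<theta>)" .
    have "measure \<nu> {circ \<theta>} * (1 / (2 * pi * y)) = (\<integral>\<zeta>. indicator {circ \<theta>} \<zeta> * (1 / (2 * pi * y)) \<partial>\<nu>)"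
      by (simp add: sets_nu)
    also have "\<dots> \<le> (\<integral>\<zeta>. poisson_kernel (of_real \<rho> * circ \<theta>) \<zeta> \<partial>\<nu>)"
    proof (rule integral_mono)
      show "integrable \<nu> (\<lambda>\<zeta>. indicator {circ \<theta>} \<zeta> * (1 / (2 * pi * y)))"
        by (intro integrable_mult_left) (simp add: sets_nu emeasure_eq_measure)
      show "integrable \<nu> (poisson_kernel (of_real \<rho> * circ \<theta>))"
        by (rule integrable_circle(1)[where K = "1 / (1 - cmod (of_real \<rho> * circ \<theta>))\<^sup>2"])
          (use poisson_le[OF less1] poisson_nonneg[OF less1] in auto)
      show "indicator {circ \<theta>} \<zeta> * (1 / (2 * pi * y)) \<le> poisson_kernel (of_real \<rho> * circ \<theta>) \<zeta>" for \<zeta>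
        using P poisson_nonneg[OF less1, of \<zeta>] by (auto split: split_indicator)
    qed
    also have "\<dots> = Re (hp_herglotz w)" unfolding hp_herglotz_def z Re_herglotz[OF less1] ..
    finally have "measure \<nu> {circ \<theta>} \<le> 2 * pi * y * Re (hp_herglotz w)"
      using y by (simp add: field_simps)
    also have "\<dots> \<le> 2 * pi * y * (K + 2 * B * ln (1 / y))" using up y by (intro mult_left_mono) auto
    finally show ?thesis .
  qed
  have "((\<lambda>y. 2 * pi * y * (K + 2 * B * ln (1 / y))) \<longlongrightarrow> 0) (at_right 0)" by real_asymp
  moreover have "\<forall>\<^sub>F y in at_right 0. measure \<nu> {circ \<theta>} \<le> 2 * pi * y * (K + 2 * B * ln (1 / y))"
    using eventually_at_right_real[of 0 1] by (auto elim!: eventually_mono intro: main)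
  ultimately have "measure \<nu> {circ \<theta>} \<le> 0" by (intro tendsto_lowerbound) auto
  then show ?thesis by (simp add: measure_le_0_iff)
qed

text \<open>Both arcs meeting at b are compared with one value U, taken at height l above b. The
  integral of Re Q along a slice at height e is Re (\<Psi> q - \<Psi> p), two Taylor errors M away
  from l U uniformly in e; let e tend to 0.\<close>

lemma arc_estimate:
  fixes b l :: real
  assumes l: "0 < l" "l < 1"
  defines "U \<equiv> Re (hp_herglotz (Complex b l))"
  defines "E \<equiv> 32 * B * (1 + 4 * B) * exp (- U)"
  shows "\<bar>measure \<nu> (arc b l) / l - U\<bar> \<le> E" "\<bar>measure \<nu> (arc (b - l) l) / l - U\<bar> \<le> E"
proof -
  define z0 where "z0 = Complex b l"
  have convex: "convex {w. 0 < Im w}" by (rule convex_halfspace_Im_gt)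
  have "open {w. 0 < Im w}" by (rule open_halfspace_Im_gt)
  moreover have "hp_herglotz holomorphic_on {w. 0 < Im w}"
    using hp.der by (force simp: holomorphic_on_open[OF open_halfspace_Im_gt])
  ultimately obtain \<Psi> where \<Psi>': "\<And>w. w \<in> {w. 0 < Im w} \<Longrightarrow> (\<Psi> has_field_derivative hp_herglotz w) (at w within {w. 0 < Im w})"
    using holomorphic_convex_primitive'[OF convex] by blast
  have \<Psi>: "(\<Psi> has_field_derivative hp_herglotz w) (at w)" if "0 < Im w" for w
    using \<Psi>'[of w] that at_within_open[of w "{w. 0 < Im w}"] open_halfspace_Im_gt[of 0] by simp
  define M where "M = 16 * B * (1 + 4 * B) * l * exp (- U)"
  have taylor: "cmod (\<Psi> p - \<Psi> z0 - (p - z0) * hp_herglotz z0) \<le> M"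
    if "0 < Im p" "Im p \<le> l" "\<bar>Re p - b\<bar> \<le> l" for p
  proof -
    have "cmod (p - z0) \<le> \<bar>Re (p - z0)\<bar> + \<bar>Im (p - z0)\<bar>" by (rule cmod_le)
    also have "\<dots> \<le> 2 * l" using that by (simp add: z0_def)
    finally have d0: "cmod (p - z0) \<le> 2 * l" .
    have "cmod (\<Psi> p - \<Psi> z0 - (p - z0) * hp_herglotz z0) \<le> 16 * B * (1 + 4 * B) * l * exp (- Re (hp_herglotz z0))"
    proof (rule hp.primitive_taylor)
      show "Im z0 = l" by (simp add: z0_def)
      show "0 < l" "0 \<le> Im p" "cmod (p - z0) \<le> 2 * l" "0 < Im p" using l that d0 by auto
    qed (rule \<Psi>)
    moreover have "U = Re (hp_herglotz z0)" by (simp add: U_def z0_def)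
    ultimately show ?thesis unfolding M_def by metis
  qed
  have slice: "\<bar>integral {a..a + l} (\<lambda>x. Re (hp_herglotz (Complex x e))) - l * U\<bar> \<le> 2 * M"
    if e: "0 < e" "e \<le> l" and a: "a = b \<or> a = b - l" for a e
  proof -
    define p q where "p = Complex a e" and "q = Complex (a + l) e"
    have "((\<lambda>x. hp_herglotz (Complex x e)) has_integral \<Psi> (Complex (a + l) e) - \<Psi> (Complex a e)) {a..a + l}"
    proof (rule fundamental_theorem_of_calculus)
      fix x
      have "((\<lambda>x. Complex x e) has_vector_derivative 1) (at x)"
      proof -
        have "(\<lambda>x. Complex x e) = (\<lambda>x. of_real x + \<i> * of_real e)" by (auto simp: complex_eq_iff)
        then show ?thesis by (auto intro!: derivative_eq_intros has_vector_derivative_real_field)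
      qed
      from field_vector_diff_chain_at[OF this \<Psi>] e
      show "((\<lambda>x. \<Psi> (Complex x e)) has_vector_derivative hp_herglotz (Complex x e)) (at x within {a..a + l})"
        by (auto simp: o_def intro: has_vector_derivative_at_within)
    qed (use l in simp)
    from has_integral_linear[OF this bounded_linear_Re]
    have eq: "integral {a..a + l} (\<lambda>x. Re (hp_herglotz (Complex x e))) = Re (\<Psi> q - \<Psi> p)"
      by (simp add: o_def integral_unique p_def q_def)
    \<comment> \<open>Both expansions are taken at z0; subtracting them leaves the linear term (q -
      p) Q = l Q.\<close>
    have id: "\<Psi> q - \<Psi> p - l * hp_herglotz z0
        = (\<Psi> q - \<Psi> z0 - (q - z0) * hp_herglotz z0) - (\<Psi> p - \<Psi> z0 - (p - z0) * hp_herglotz z0)"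
    proof -
      have "q - p = of_real l" by (simp add: p_def q_def complex_eq_iff)
      then have "of_real l * hp_herglotz z0 = (q - p) * hp_herglotz z0" by simp
      then show ?thesis by (simp add: algebra_simps)
    qed
    have "cmod ((\<Psi> q - \<Psi> z0 - (q - z0) * hp_herglotz z0) - (\<Psi> p - \<Psi> z0 - (p - z0) * hp_herglotz z0)) \<le> M + M"
      using a e l by (intro norm_triangle_le_diff add_mono taylor) (auto simp: p_def q_def)
    then have "cmod (\<Psi> q - \<Psi> p - l * hp_herglotz z0) \<le> 2 * M"
      by (simp only: id mult_2)
    then have "\<bar>Re (\<Psi> q - \<Psi> p - l * hp_herglotz z0)\<bar> \<le> 2 * M"
      using abs_Re_le_cmod order.trans by blast
    then show ?thesis unfolding eq U_def z0_def by simp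
  qed
  define e where "e = (\<lambda>n. l / (real n + 1))"
  have e: "0 < e n" "e n \<le> l" for n using l by (auto simp: e_def field_simps)
  have e0: "(\<lambda>n. exp (- 2 * pi * e n)) \<longlonglongrightarrow> 1" unfolding e_def by real_asymp
  have lim: "\<bar>measure \<nu> (arc a l) - l * U\<bar> \<le> 2 * M" if a: "a = b \<or> a = b - l" for a
  proof -
    have "(\<lambda>n. integral {a..a + l} (\<lambda>x. Re (herglotz (of_real (exp (- 2 * pi * e n)) * circ x)))) \<longlonglongrightarrow> measure \<nu> (arc a l)"
      by (rule herglotz_arc_tendsto[OF e0 _ _ l no_atoms]) (use e in auto)
    then have "(\<lambda>n. integral {a..a + l} (\<lambda>x. Re (hp_herglotz (Complex x (e n))))) \<longlonglongrightarrow> measure \<nu> (arc a l)"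
      by (simp add: hp_herglotz_def hp_exp_eq)
    then have "(\<lambda>n. \<bar>integral {a..a + l} (\<lambda>x. Re (hp_herglotz (Complex x (e n)))) - l * U\<bar>)
        \<longlonglongrightarrow> \<bar>measure \<nu> (arc a l) - l * U\<bar>"
      by (intro tendsto_intros)
    then show ?thesis
      by (rule tendsto_upperbound) (use slice[OF e a] in auto)
  qed
  have "\<bar>measure \<nu> (arc a l) / l - U\<bar> \<le> E" if a: "a = b \<or> a = b - l" for a
  proof -
    have "measure \<nu> (arc a l) / l - U = (measure \<nu> (arc a l) - l * U) / l" using l by (simp add: field_simps)
    then have "\<bar>measure \<nu> (arc a l) / l - U\<bar> = \<bar>measure \<nu> (arc a l) - l * U\<bar> / l" using l by simp
    also have "\<dots> \<le> 2 * M / l" using lim[OF a] l by (intro divide_right_mono) auto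
    also have "\<dots> = E" using l by (simp add: M_def E_def)
    finally show ?thesis .
  qed
  then show "\<bar>measure \<nu> (arc b l) / l - U\<bar> \<le> E" "\<bar>measure \<nu> (arc (b - l) l) / l - U\<bar> \<le> E" by auto
qed

lemma contiguous_arcs_of_bloch_bound: "\<exists>C>0. contiguous_arc_cond C"
proof -
  define m where "m = 32 * B * (1 + 4 * B)"
  have m: "0 \<le> m" using hp.B_nonneg by (simp add: m_def)
  \<comment> \<open>Both means are within m exp (- U) of U; replacing exp (- U) by exp (- x) costs
    exp m because |x - U| \<le> m. The 1 ensures C > 0 even if B = 0.\<close>
  define C where "C = 2 * m * exp m + 1"
  have C: "0 < C" using m by (simp add: C_def add_nonneg_pos)
  have main: "\<bar>x - y\<bar> \<le> C * exp (- x)"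
    if x: "\<bar>x - U\<bar> \<le> m * exp (- U)" and y: "\<bar>y - U\<bar> \<le> m * exp (- U)" and U: "0 \<le> U" for x y U
  proof -
    have "m * exp (- U) \<le> m * 1" using m U by (intro mult_left_mono) auto
    then have "exp (- U) \<le> exp (m - x)" using x by simp
    also have "\<dots> = exp m * exp (- x)" by (simp add: exp_diff exp_minus field_simps)
    finally have e: "exp (- U) \<le> exp m * exp (- x)" .
    have "\<bar>x - y\<bar> \<le> 2 * m * exp (- U)" using x y by linarith
    also have "\<dots> \<le> 2 * m * (exp m * exp (- x))" using m e by (intro mult_left_mono) auto
    also have "\<dots> \<le> C * exp (- x)" by (simp add: C_def algebra_simps)
    finally show ?thesis .
  qed
  have "contiguous_arc_cond C"
    unfolding contiguous_arc_cond_def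
  proof (intro allI impI ballI)
    fix a l a' :: real assume l: "0 < l \<and> l \<le> 1/2" and a': "a' \<in> {a + l, a - l}"
    have l': "0 < l" "l < 1" using l by auto
    have nn: "0 \<le> Re (hp_herglotz (Complex b l))" for b using l' by (intro hp.nonneg) simp
    note ae = arc_estimate[OF l', folded m_def]
    show "\<bar>measure \<nu> (arc a l) / l - measure \<nu> (arc a' l) / l\<bar> \<le> C * exp (- (measure \<nu> (arc a l) / l))"
    \<comment> \<open>The common endpoint, at which \<open>arc_estimate\<close> is applied, is a + l
      or a.\<close>
    proof (cases "a' = a + l")
      case True
      then show ?thesis using main[OF ae(2)[of "a + l"] ae(1)[of "a + l"] nn] by simp
    next
      case False
      then have "a' = a - l" using a' by auto
      then show ?thesis using main[OF ae(1)[of a] ae(2)[of a] nn] by simp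
    qed
  qed
  then show ?thesis using C by blast
qed

end

end

theorem theorem1p8:
  fixes f :: "complex \<Rightarrow> complex" and \<nu> :: "complex measure"
  assumes "Hinf_unit_ball f"
    and "\<forall>z\<in>ball 0 1. f z \<noteq> 0"
    and "HN_measure f \<nu>"
  shows "bloch (\<lambda>z. 1 / f z) \<longleftrightarrow>
    (\<exists>C>0. \<forall>a l. 0 < l \<and> l \<le> 1/2 \<longrightarrow>
       (\<forall>a'\<in>{a + l, a - l}.
          \<bar>measure \<nu> (arc a l) / l - measure \<nu> (arc a' l) / l\<bar>
            \<le> C * exp (- (measure \<nu> (arc a l) / l))))"
proof -
  interpret finite_measure \<nu> using assms(3) by (simp add: HN_measure_def)
  interpret circle_measure \<nu>
    by unfold_locales (use assms(3) in \<open>auto simp: HN_measure_def\<close>)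
  have "bloch (\<lambda>z. 1 / f z) \<longleftrightarrow>
      (\<exists>B. \<forall>z\<in>ball 0 1. (1 - cmod z) * (cmod (herglotz_deriv z) * exp (Re (herglotz z))) \<le> B)"
    using assms by (intro bloch_iff_herglotz) (auto simp: Hinf_unit_ball_def HN_measure_def)
  also have "\<dots> \<longleftrightarrow> (\<exists>C>0. contiguous_arc_cond C)"
  proof
    assume "\<exists>C>0. contiguous_arc_cond C"
    then obtain C where "0 \<le> C" "contiguous_arc_cond C" by (meson less_imp_le)
    then show "\<exists>B. \<forall>z\<in>ball 0 1. (1 - cmod z) * (cmod (herglotz_deriv z) * exp (Re (herglotz z))) \<le> B"
      by (rule bloch_bound_of_contiguous_arcs)
  qed (use contiguous_arcs_of_bloch_bound in blast)
  finally show ?thesis unfolding contiguous_arc_cond_def .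
qed

end
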